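(* Let $\lambda$ and $\mu$ be decompositions of $n+1$. The groups $P_{\lambda|\mu}$ and $\left\langle A_{2,n}(S_{\lambda|\mu})\right\rangle$ are isomorphic.
   Context: A two-dimensional Coxeter system is a triple $(X,f,g)$ with $f\colon \binom{X}{2}\to\mathbb{N}$ and $g\colon\binom{X}{3}\to\mathbb{N}$ (viewed as symmetric functions on $X^2$, $X^3$). The associated group $\langle X,f,g\rangle$ is generated by $X$ subject to the relations $x^2=e$, $(xy)^{f(x,y)}=e$, $(xyz)^{g(x,y,z)}=e$ for $x,y,z\in X$ (a value $0$ imposes no relation). For a subset $S\subseteq X$, $(X,f,g)(S)$ denotes the system obtained by restricting $f$ and $g$ to $S$. The system $A_{2,n}$ has $X=\{x_1,\dots,x_n,y_1,\dots,y_n\}$, with $f(x_i,x_{i+1})=f(y_i,y_{i+1})=4$ for $1\le i\le n-1$, $f(x_i,y_i)=3$ for $1\le i\le n$, and $f=2$ on all other pairs; and $g(x_i,x_{i+1},y_i)=g(x_i,x_{i+1},y_{i+1})=g(x_i,y_i,y_{i+1})=g(x_{i+1},y_i,y_{i+1})=3$ for $1\le i\le n-1$, $g(x_i,x_{i+1},x_{i+2})=g(y_i,y_{i+1},y_{i+2})=4$ for $1\le i\le n-2$, and $g=0$ on all other triples. For a decomposition $\lambda=(\lambda_1,\dots,\lambda_l)$ of $n+1$ into non-zero parts, $P_\lambda$ is the standard parabolic subgroup of $\mathrm{GL}_{n+1}(\mathbb{F}_2)$ of block upper-triangular matrices with diagonal blocks in $\mathrm{GL}_{\lambda_1}(\mathbb{F}_2),\dots,\mathrm{GL}_{\lambda_l}(\mathbb{F}_2)$,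 and $P_{\lambda|\mu}=P_\lambda\cap P_\mu^t$ (where $P_\mu^t$ is the group of transposes of elements of $P_\mu$). The set of stopovers is $\overline{s}(\lambda)=\{\lambda_1,\lambda_1+\lambda_2,\dots,\lambda_1+\dots+\lambda_{l-1}\}$, and $S_{\lambda|\mu}=\{x_i : i\notin\overline{s}(\lambda)\}\cup\{y_j : j\notin\overline{s}(\mu)\}\subseteq X$. *)

theory Defs
  imports "HOL-Algebra.Group" "HOL-Library.Z2"
begin

inductive_set pres_eq :: "'a set \<Rightarrow> 'a list set \<Rightarrow> ('a list \<times> 'a list) set"
  for S :: "'a set" and R :: "'a list set" where
  refl: "set w \<subseteq> S \<Longrightarrow> (w, w) \<in> pres_eq S R"
| sym: "(u, v) \<in> pres_eq S R \<Longrightarrow> (v, u) \<in> pres_eq S R"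
| trans: "(u, v) \<in> pres_eq S R \<Longrightarrow> (v, w) \<in> pres_eq S R \<Longrightarrow> (u, w) \<in> pres_eq S R"
| rel: "set u \<subseteq> S \<Longrightarrow> set v \<subseteq> S \<Longrightarrow> r \<in> R \<Longrightarrow> set r \<subseteq> S
        \<Longrightarrow> (u @ r @ v, u @ v) \<in> pres_eq S R"

text \<open>The monoid of words over S modulo the congruence generated by the relators R.
  When R contains every [a,a], a in S, this is the group generated by S subject to
  the relations r = e for r in R.\<close>
definition presented_group :: "'a set \<Rightarrow> 'a list set \<Rightarrow> 'a list set monoid" where
  "presented_group S R =
     \<lparr> carrier = lists S // pres_eq S R,
       mult = (\<lambda>A B. pres_eq S R `` {(SOME a. a \<in> A) @ (SOME b. b \<in> B)}),
       one = pres_eq S R `` {[]} \<rparr>"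

definition word_pow :: "'a list \<Rightarrow> nat \<Rightarrow> 'a list" where
  "word_pow w m = concat (replicate m w)"

text \<open>Relators of the system (X,f,g)(S): x^2, (xy)^f(x,y), (xyz)^g(x,y,z)
  (exponent 0 gives the empty word, i.e. no relation).\<close>
definition coxeter2_relators ::
  "'a set \<Rightarrow> ('a \<Rightarrow> 'a \<Rightarrow> nat) \<Rightarrow> ('a \<Rightarrow> 'a \<Rightarrow> 'a \<Rightarrow> nat) \<Rightarrow> 'a list set" where
  "coxeter2_relators S f g =
     {[a, a] | a. a \<in> S}
   \<union> {word_pow [a, b] (f a b) | a b. a \<in> S \<and> b \<in> S \<and> a \<noteq> b}
   \<union> {word_pow [a, b, c] (g a b c) | a b c. a \<in> S \<and> b \<in> S \<and> c \<in> S \<and> distinct [a, b, c]}"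

definition coxeter2_group ::
  "'a set \<Rightarrow> ('a \<Rightarrow> 'a \<Rightarrow> nat) \<Rightarrow> ('a \<Rightarrow> 'a \<Rightarrow> 'a \<Rightarrow> nat) \<Rightarrow> 'a list set monoid" where
  "coxeter2_group S f g = presented_group S (coxeter2_relators S f g)"

datatype gen = Xg nat | Yg nat

definition A2_X :: "nat \<Rightarrow> gen set" where
  "A2_X n = {Xg i | i. 1 \<le> i \<and> i \<le> n} \<union> {Yg i | i. 1 \<le> i \<and> i \<le> n}"

definition A2_f :: "nat \<Rightarrow> gen \<Rightarrow> gen \<Rightarrow> nat" where
  "A2_f n a b =
    (if \<exists>i. 1 \<le> i \<and> i < n \<and> ({a, b} = {Xg i, Xg (Suc i)} \<or> {a, b} = {Yg i, Yg (Suc i)}) then 4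
     else if \<exists>i. 1 \<le> i \<and> i \<le> n \<and> {a, b} = {Xg i, Yg i} then 3
     else 2)"

definition A2_g :: "nat \<Rightarrow> gen \<Rightarrow> gen \<Rightarrow> gen \<Rightarrow> nat" where
  "A2_g n a b c =
    (if \<exists>i. 1 \<le> i \<and> i < n \<and>
          ({a, b, c} = {Xg i, Xg (Suc i), Yg i} \<or> {a, b, c} = {Xg i, Xg (Suc i), Yg (Suc i)}
         \<or> {a, b, c} = {Xg i, Yg i, Yg (Suc i)} \<or> {a, b, c} = {Xg (Suc i), Yg i, Yg (Suc i)}) then 3
     else if \<exists>i. 1 \<le> i \<and> i + 2 \<le> n \<and>
          ({a, b, c} = {Xg i, Xg (i+1), Xg (i+2)} \<or> {a, b, c} = {Yg i, Yg (i+1), Yg (i+2)}) then 4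
     else 0)"

definition A2_group :: "nat \<Rightarrow> gen set \<Rightarrow> gen list set monoid" where
  "A2_group n S = coxeter2_group S (A2_f n) (A2_g n)"

definition is_decomposition :: "nat list \<Rightarrow> nat \<Rightarrow> bool" where
  "is_decomposition lam m \<longleftrightarrow> (\<forall>p \<in> set lam. 0 < p) \<and> sum_list lam = m"

definition stopovers :: "nat list \<Rightarrow> nat set" where
  "stopovers lam = {sum_list (take k lam) | k. 1 \<le> k \<and> k < length lam}"

definition S_lm :: "nat \<Rightarrow> nat list \<Rightarrow> nat list \<Rightarrow> gen set" where
  "S_lm n lam mu = {Xg i | i. 1 \<le> i \<and> i \<le> n \<and> i \<notin> stopovers lam}
              \<union> {Yg j | j. 1 \<le> j \<and> j \<le> n \<and> j \<notin> stopovers mu}"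

text \<open>m x m matrices over F_2 are functions nat => nat => bit, indices 0..m-1, zero elsewhere.\<close>
definition mat_mul :: "nat \<Rightarrow> (nat \<Rightarrow> nat \<Rightarrow> bit) \<Rightarrow> (nat \<Rightarrow> nat \<Rightarrow> bit) \<Rightarrow> nat \<Rightarrow> nat \<Rightarrow> bit" where
  "mat_mul m A B = (\<lambda>i j. if i < m \<and> j < m then (\<Sum>k<m. A i k * B k j) else 0)"

definition mat_one :: "nat \<Rightarrow> nat \<Rightarrow> nat \<Rightarrow> bit" where
  "mat_one m = (\<lambda>i j. if i = j \<and> i < m then 1 else 0)"

definition GL_set :: "nat \<Rightarrow> (nat \<Rightarrow> nat \<Rightarrow> bit) set" where
  "GL_set m = {A. (\<forall>i j. \<not> (i < m \<and> j < m) \<longrightarrow> A i j = 0) \<and>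
      (\<exists>B. (\<forall>i j. \<not> (i < m \<and> j < m) \<longrightarrow> B i j = 0) \<and>
           mat_mul m A B = mat_one m \<and> mat_mul m B A = mat_one m)}"

text \<open>Block index of the (0-based) row/column index i for the composition lambda:
  the 1-based index i+1 lies in block number card of stopovers below it.\<close>
definition block_of :: "nat list \<Rightarrow> nat \<Rightarrow> nat" where
  "block_of lam i = card {s \<in> stopovers lam. s \<le> i}"

definition P_set :: "nat \<Rightarrow> nat list \<Rightarrow> (nat \<Rightarrow> nat \<Rightarrow> bit) set" where
  "P_set m lam = {A \<in> GL_set m. \<forall>i j. A i j \<noteq> 0 \<longrightarrow> block_of lam i \<le> block_of lam j}"

definition P_lm_group :: "nat \<Rightarrow> nat list \<Rightarrow> nat list \<Rightarrow> (nat \<Rightarrow> nat \<Rightarrow> bit) monoid" where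
  "P_lm_group n lam mu =
     \<lparr> carrier = P_set (Suc n) lam \<inter> {A. (\<lambda>i j. A j i) \<in> P_set (Suc n) mu},
       mult = mat_mul (Suc n),
       one = mat_one (Suc n) \<rparr>"

end

theory Submission
  imports Defs
begin

text \<open>
  The generators x_i and y_i act on the vectors over F_2 by the lower and upper elementary
  transvections between the coordinates i-1 and i (0-based), which satisfies the relations.

  For faithfulness, let G_k be the subgroup of the presented group generated by the x_i, y_i in S
  with i at most k. Iterated commutators E(i,k) of x_i, ..., x_k play the role of the elementary
  matrices with entry (k, i-1), and the relations of length at most three imply all Steinberg
  relations between them and the generators; the same holds for the y_i. Let R and C be the
  elementary abelian subgroups belonging to row k+1 and column k+1. Both are normalised
  by G_k, and G_(k+1) = G_k C R, together with a second cell G_k C w G_k, where w = x y x, if both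
  x_(k+1) and y_(k+1) are present. Reading off row and column k+1 shows that an element acting
  trivially lies in the first cell with trivial C and R parts, hence in G_k, and induction on k
  applies.

  Surjectivity is row and column reduction: if the entry (p,p) of the last non-trivial cross
  vanishes, then row p or column p has a non-zero entry whose index is equivalent to p for the
  preorder of admissible positions.
\<close>

section \<open>The unipotent part\<close>

text \<open>The index sets P and Q of the x_i and y_i are arbitrary, so an iterated commutator is
  used only over an interval that lies inside P (or Q); all relations are proved interval by
  interval. The obstacle in deriving the Steinberg relations is that row k must commute with row k+1
  apart from x_(k+1). The relation (x_i x_(i+1) x_(i+2))^4 is its shortest non-trivial instance, and
  the remaining ones follow by conjugation with generators that are far away. The relations with
  exponent 3 play the same part for conjugation by an opposite generator. The second cell is forced
  by one product. Right multiplication of G_k C R by y_(k+1) stays inside that set until the R part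
  contains x_(k+1), and then x y = y w brings in w. The union of both cells is closed under right
  multiplication by all generators, which gives the decomposition; the cells are told apart
  afterwards, by the action. Everything about columns is obtained from rows by exchanging x and
  y.\<close>

definition commute :: "'a::monoid_mult \<Rightarrow> 'a \<Rightarrow> bool" where
  "commute a b \<longleftrightarrow> a * b = b * a"

definition invo :: "'a::monoid_mult \<Rightarrow> bool" where
  "invo a \<longleftrightarrow> a * a = 1"

lemma commute_sym: "commute a b \<Longrightarrow> commute b a"
  by (simp add: commute_def)

lemma commute_left: "commute a b \<Longrightarrow> a * (b * z) = b * (a * z)"
  by (simp add: commute_def flip: mult.assoc)

lemma commute_mult: "commute a b \<Longrightarrow> commute a c \<Longrightarrow> commute a (b * c)"
  unfolding commute_def by (metis mult.assoc)

lemma commute_one [simp]: "commute a 1" "commute 1 a"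
  by (simp_all add: commute_def)

lemma commute_refl [simp]: "commute a a"
  by (simp add: commute_def)

lemma invo_left: "invo a \<Longrightarrow> a * (a * z) = z"
  by (simp add: invo_def flip: mult.assoc)

lemma commute_conj:
  assumes c: "invo c" and "commute a (c * b * c)"
  shows "commute (c * a * c) b"
proof -
  have "c * a * c * b = c * (a * (c * b * c)) * c"
    using c by (simp add: mult.assoc invo_def)
  also have "\<dots> = c * ((c * b * c) * a) * c"
    using assms by (simp add: commute_def)
  also have "\<dots> = b * (c * a * c)"
    using c by (simp add: mult.assoc invo_left)
  finally show ?thesis by (simp add: commute_def)
qed

lemma invo_mult: "invo a \<Longrightarrow> invo b \<Longrightarrow> commute a b \<Longrightarrow> invo (a * b)"
  by (simp add: invo_def[of "a * b"] invo_left mult.assoc commute_left[of a b])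
    (simp add: invo_def)

lemma invo_conj: "invo c \<Longrightarrow> invo a \<Longrightarrow> invo (c * a * c)"
  unfolding invo_def[of "c * a * c"] by (simp add: invo_left mult.assoc) (simp add: invo_def)

lemma conj_swap:
  assumes c: "invo c"
  shows "c * a * c = b \<longleftrightarrow> c * a = b * c"
proof
  assume "c * a * c = b"
  then have "b * c = c * a * (c * c)" by (metis mult.assoc)
  then show "c * a = b * c" using c by (simp add: invo_def)
next
  assume "c * a = b * c"
  then have "c * a * c = b * (c * c)" by (simp add: mult.assoc)
  then show "c * a * c = b" using c by (simp add: invo_def)
qed

lemma commute_conj_iff: "invo c \<Longrightarrow> c * a * c = a \<longleftrightarrow> commute c a"
  by (simp add: conj_swap commute_def)

lemma conj_mult: "invo c \<Longrightarrow> c * (a * b) * c = (c * a * c) * (c * b * c)"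
  by (simp add: invo_left mult.assoc)

lemma pow4: "(a::'a::monoid_mult)^4 = a*a*a*a"
  by (simp add: eval_nat_numeral mult.assoc)

lemma pow3: "(a::'a::monoid_mult)^3 = a*a*a"
  by (simp add: eval_nat_numeral mult.assoc)

text \<open>For involutions, (ab)^4 = 1 amounts to abab = baba. Hence the commutator abab of
  neighbouring generators is a product of two commuting involutions, a and bab.\<close>

lemma pow4_commute_conj:
  assumes "invo a" "invo b" "(a * b)^4 = 1"
  shows "commute a (b * a * b)"
proof -
  have "a*b*a*b*(a*b*a*b) = 1" using assms(3) by (simp add: pow4 mult.assoc)
  then have "a*b*a*b*(a*b*a*b) * (b*a*b*a) = b*a*b*a" by simp
  then have "a*b*a*b = b*a*b*a" using assms(1,2) by (simp add: mult.assoc invo_left invo_def)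
  then show ?thesis by (simp add: commute_def mult.assoc)
qed

text \<open>Writing d = (ab)^2 and f = (bc)^2, one has (abc)^2 = df, so the hypothesis says that d and f commute.\<close>
lemma pow4_triple:
  assumes a: "invo a" and b: "invo b" and c: "invo c" and ac: "commute a c"
    and ab: "(a * b)^4 = 1" and bc: "(b * c)^4 = 1" and abc: "(a * b * c)^4 = 1"
  shows "commute (a * b * a * b) (c * b * c)"
proof -
  let ?d = "a * b * a * b" and ?f = "b * c * b * c"
  have cb: "commute a (b * a * b)" using pow4_commute_conj[OF a b ab] .
  have d: "invo ?d" using invo_mult[OF a invo_conj[OF b a] cb] by (simp add: mult.assoc)
  have cb2: "commute b (c * b * c)" using pow4_commute_conj[OF b c bc] .
  have f: "invo ?f" using invo_mult[OF b invo_conj[OF c b] cb2] by (simp add: mult.assoc)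
  have sq: "a * b * c * (a * b * c) = ?d * ?f"
  proof -
    have "a * b * c * (a * b * c) = a * b * (c * a) * b * c" by (simp add: mult.assoc)
    also have "c * a = a * c" using ac by (simp add: commute_def)
    also have "a * b * (a * c) * b * c = ?d * ?f" using b by (simp add: mult.assoc invo_left)
    finally show ?thesis .
  qed
  have "?d * ?f * (?d * ?f) = 1"
    using abc unfolding sq[symmetric] by (simp add: pow4 mult.assoc)
  then have "?d * (?d * ?f * (?d * ?f)) * ?f = ?d * ?f" by (simp only: mult_1_right mult_1_left)
  moreover have "?d * (?d * ?f * (?d * ?f)) * ?f = ?f * ?d"
    using invo_left[OF d] f unfolding invo_def by (simp only: mult.assoc mult_1_right)
  ultimately have df: "commute ?d ?f" by (simp add: commute_def)
  have "commute ?d b"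
    using cb b by (simp add: commute_def mult.assoc invo_def)
  then have "commute ?d (b * ?f)" using df by (rule commute_mult)
  moreover have "b * ?f = c * b * c" using b by (simp add: mult.assoc invo_left)
  ultimately show ?thesis by simp
qed

text \<open>Iterated commutator of x_i, ..., x_k; for the lower transvections x_j it is the elementary
  matrix with 0-based entry (k, i-1). Junk for i > k.\<close>
fun icomm :: "(nat \<Rightarrow> 'a::monoid_mult) \<Rightarrow> nat \<Rightarrow> nat \<Rightarrow> 'a" where
  "icomm x i 0 = x 0"
| "icomm x i (Suc k) = (if i \<le> k then icomm x i k * (x (Suc k) * icomm x i k * x (Suc k)) else x (Suc k))"

lemma icomm_self [simp]: "icomm x i i = x i"
  by (cases i) auto

lemma icomm_commute:
  assumes "\<And>j. i \<le> j \<Longrightarrow> j \<le> k \<Longrightarrow> commute g (x j)" and "i \<le> k"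
  shows "commute g (icomm x i k)"
  using assms
proof (induction k)
  case (Suc k)
  then show ?case by (cases "i \<le> k") (auto intro!: commute_mult)
qed simp

locale unipotent =
  fixes x :: "nat \<Rightarrow> 'g::monoid_mult" and P :: "nat set"
  assumes x_invo: "i \<in> P \<Longrightarrow> invo (x i)"
    and x_far: "i \<in> P \<Longrightarrow> j \<in> P \<Longrightarrow> Suc i < j \<Longrightarrow> commute (x i) (x j)"
    and x_pow4: "i \<in> P \<Longrightarrow> Suc i \<in> P \<Longrightarrow> (x i * x (Suc i))^4 = 1"
    and x_triple: "i \<in> P \<Longrightarrow> Suc i \<in> P \<Longrightarrow> Suc (Suc i) \<in> P \<Longrightarrow>
       (x i * x (Suc i) * x (Suc (Suc i)))^4 = 1"
begin

abbreviation E :: "nat \<Rightarrow> nat \<Rightarrow> 'g" where "E \<equiv> icomm x"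

text \<open>The clauses are proved together because each one at k+1 uses others at k. In the third,
  x_(k+1) x_k x_(k+1) equals x_k times \<open>E k (Suc k)\<close>, so the clause makes row k commute
  with an element of row k+1. The case i = k is left out because \<open>pow4_commute_conj\<close>
  supplies it.\<close>

definition steinberg_upto :: "nat \<Rightarrow> bool" where
  "steinberg_upto k \<longleftrightarrow> (\<forall>i\<le>k. {i..k} \<subseteq> P \<longrightarrow>
     invo (E i k) \<and> (\<forall>j\<in>{i..k}. commute (x j) (E i k)) \<and>
     (i < k \<longrightarrow> Suc k \<in> P \<longrightarrow> commute (E i k) (x (Suc k) * x k * x (Suc k))) \<and>
     (\<forall>h. i = Suc h \<longrightarrow> h \<in> P \<longrightarrow> x h * E i k * x h = E h k * E i k))"

lemma steinberg_uptoD: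
  assumes "steinberg_upto k" "i \<le> k" "{i..k} \<subseteq> P"
  shows "invo (E i k)" "\<And>j. i \<le> j \<Longrightarrow> j \<le> k \<Longrightarrow> commute (x j) (E i k)"
    "i < k \<Longrightarrow> Suc k \<in> P \<Longrightarrow> commute (E i k) (x (Suc k) * x k * x (Suc k))"
    "\<And>h. i = Suc h \<Longrightarrow> h \<in> P \<Longrightarrow> x h * E i k * x h = E h k * E i k"
  using assms unfolding steinberg_upto_def by (simp_all del: icomm.simps)

text \<open>\<open>E i k\<close> is a word in x_i, ..., x_k, so commuting with each x_j suffices.
  For j < k both x_(k+1) and \<open>E h k\<close> commute with x_j; for j = k it is the third
  clause, conjugated by x_(k+1).\<close>

lemma steinberg_conj_commute:
  assumes g: "steinberg_upto k" and hi: "h \<le> i" "i \<le> k" and P: "{h..Suc k} \<subseteq> P"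
  shows "commute (x (Suc k) * E h k * x (Suc k)) (E i k)"
proof (cases "h = k")
  case True
  then have "k \<in> P" "Suc k \<in> P" "i = k" using hi P by auto
  then show ?thesis
    using commute_sym[OF pow4_commute_conj[OF x_invo x_invo x_pow4, of k]] True by simp
next
  case False
  have sub: "{h..k} \<subseteq> P" "Suc k \<in> P" "h < k" using P hi False by auto
  have c: "invo (x (Suc k))" using sub by (simp add: x_invo)
  show ?thesis
  proof (rule icomm_commute)
    fix j assume j: "i \<le> j" "j \<le> k"
    show "commute (x (Suc k) * E h k * x (Suc k)) (x j)"
    proof (cases "j = k")
      case True
      have "commute (E h k) (x (Suc k) * x k * x (Suc k))"
        using steinberg_uptoD(3)[OF g _ sub(1)] sub by simp
      then show ?thesis using True commute_conj[OF c] by simp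
    next
      case False
      have "j \<in> P" using j hi sub by auto
      then have "commute (x j) (x (Suc k))" using x_far[of j "Suc k"] sub j False by auto
      moreover have "commute (x j) (E h k)" using steinberg_uptoD(2)[OF g _ sub(1)] sub(3) hi j by simp
      ultimately show ?thesis by (intro commute_sym[of "x j"] commute_mult)
    qed
  qed (use hi in simp)
qed

lemma E_Suc: "i \<le> k \<Longrightarrow> E i (Suc k) = E i k * (x (Suc k) * E i k * x (Suc k))"
  by simp

lemma steinberg_upto_Suc:
  assumes g: "steinberg_upto k"
  shows "steinberg_upto (Suc k)"
proof -
  let ?c = "x (Suc k)"
  have seg: "{i..k} \<subseteq> P" "Suc k \<in> P" if "i \<le> k" "{i..Suc k} \<subseteq> P" for i
    using that by auto
  have a: "invo (E i (Suc k))" if i: "i \<le> Suc k" "{i..Suc k} \<subseteq> P" for i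
  proof (cases "i \<le> k")
    case True
    note s = seg[OF True i(2)]
    have "commute (E i k) (?c * E i k * ?c)"
      using steinberg_conj_commute[OF g order_refl True i(2)] by (rule commute_sym)
    then show ?thesis unfolding E_Suc[OF True]
      using steinberg_uptoD(1)[OF g True s(1)] x_invo[OF s(2)] by (intro invo_mult invo_conj)
  next
    case False
    then have "i = Suc k" using i by simp
    then show ?thesis using i by (simp del: icomm.simps add: x_invo)
  qed
  have b: "commute (x j) (E i (Suc k))" if i: "i \<le> Suc k" "{i..Suc k} \<subseteq> P" and j: "i \<le> j" "j \<le> Suc k" for i j
  proof (cases "i \<le> k")
    case ik: True
    note s = seg[OF ik i(2)]
    have *: "commute (E i k) (?c * E i k * ?c)"
      using steinberg_conj_commute[OF g order_refl ik i(2)] by (rule commute_sym)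
    show ?thesis
    proof (cases "j = Suc k")
      case True
      \<comment> \<open>Conjugation by x_(k+1) swaps the two factors of \<open>E i (Suc k)\<close>,
        and these commute.\<close>
      have "?c * (E i k * (?c * E i k * ?c)) = (?c * E i k * ?c) * E i k * ?c"
        by (simp add: mult.assoc)
      also have "(?c * E i k * ?c) * E i k = E i k * (?c * E i k * ?c)"
        using * by (simp add: commute_def)
      finally have "?c * (E i k * (?c * E i k * ?c)) = (E i k * (?c * E i k * ?c)) * ?c" .
      then show ?thesis using True by (simp only: commute_def E_Suc[OF ik])
    next
      case False
      then have jk: "j \<le> k" using j by simp
      have jE: "commute (x j) (E i k)" using steinberg_uptoD(2)[OF g ik s(1) j(1) jk] .
      have "commute (?c * E i k * ?c) (x j)"
      proof (cases "j = k")
        case True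
        have "commute (?c * E i k * ?c) (E k k)"
          using steinberg_conj_commute[OF g ik order_refl i(2)] .
        then show ?thesis using True by simp
      next
        case False
        have "j \<in> P" using s(1) j jk by auto
        then have "commute (x j) ?c" using x_far[of j "Suc k"] s jk False by simp
        then show ?thesis using jE by (intro commute_sym[of "x j"] commute_mult)
      qed
      then show ?thesis unfolding E_Suc[OF ik] using commute_mult[OF jE commute_sym] by simp
    qed
  next
    case False
    then have "i = Suc k" "j = Suc k" using i j by auto
    then show ?thesis by (simp del: icomm.simps)
  qed
  have d: "x h * E (Suc h) (Suc k) * x h = E h (Suc k) * E (Suc h) (Suc k)"
    if h: "h \<le> k" "{h..Suc k} \<subseteq> P" for h
  proof (cases "h = k")
    case True
    have "invo ?c" using seg[OF h] by (simp add: x_invo)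
    then show ?thesis using True by (simp add: mult.assoc invo_def)
  next
    case False
    then have hk: "Suc h \<le> k" using h by auto
    note s = seg[OF h]
    let ?d = "E (Suc h) k" and ?D = "E h k"
    have hP: "h \<in> P" "{Suc h..k} \<subseteq> P" using h by auto
    note xh = x_invo[OF hP(1)] and c = x_invo[OF s(2)]
    have dd: "x h * ?d * x h = ?D * ?d"
      using steinberg_uptoD(4)[OF g hk hP(2) HOL.refl hP(1)] .
    have "commute (?c * ?D * ?c) ?d"
      using steinberg_conj_commute[OF g _ hk, of h] h by simp
    note cm = commute_sym[OF this]
    have hc: "x h * ?c * x h = ?c" using x_far[of h "Suc k"] hP s hk xh
      by (simp add: commute_conj_iff)
    \<comment> \<open>x_h commutes with x_(k+1), so it acts on the two factors separately;
      \<open>cm\<close> then sorts the four resulting factors.\<close>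
    have "x h * (?d * (?c * ?d * ?c)) * x h = (x h * ?d * x h) * ((x h * ?c * x h) * (x h * ?d * x h) * (x h * ?c * x h))"
      by (simp only: conj_mult[OF xh])
    also have "\<dots> = (?D * ?d) * (?c * (?D * ?d) * ?c)" by (simp only: dd hc)
    also have "\<dots> = ?D * (?d * (?c * ?D * ?c)) * (?c * ?d * ?c)"
      using c by (simp add: mult.assoc invo_left)
    also have "\<dots> = (?D * (?c * ?D * ?c)) * (?d * (?c * ?d * ?c))"
      unfolding cm[unfolded commute_def] by (simp add: mult.assoc)
    finally show ?thesis unfolding E_Suc[OF hk] E_Suc[OF h(1)] .
  qed
  \<comment> \<open>Descending induction on i. The start i = k is the relation of length three; each
    further step writes \<open>E i\<close> through x_i and \<open>E (Suc i)\<close>, where x_i is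
    too far from x_(k+1) and x_(k+2) to interfere.\<close>
  have e: "commute (E i (Suc k)) (x (Suc (Suc k)) * x (Suc k) * x (Suc (Suc k)))"
    if "i \<le> k" "{i..Suc (Suc k)} \<subseteq> P" for i
    using that
  proof (induction "k - i" arbitrary: i)
    case 0
    then have i: "i = k" by simp
    have "k \<in> P" "Suc k \<in> P" "Suc (Suc k) \<in> P" using 0 by auto
    then show ?case
      using pow4_triple[OF x_invo x_invo x_invo x_far x_pow4 x_pow4 x_triple, of k] i
      by (simp add: mult.assoc)
  next
    case (Suc l)
    then have ik: "Suc i \<le> k" by simp
    let ?u = "x (Suc (Suc k)) * x (Suc k) * x (Suc (Suc k))"
    have sub: "{Suc i..Suc (Suc k)} \<subseteq> P" "{Suc i..Suc k} \<subseteq> P" "{i..Suc k} \<subseteq> P" "i \<in> P" "Suc k \<in> P" "Suc (Suc k) \<in> P"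
      using Suc.prems by auto
    have IH: "commute (E (Suc i) (Suc k)) ?u"
      using Suc.hyps(1)[of "Suc i"] Suc.hyps(2) ik sub(1) by (simp del: icomm.simps)
    have xi: "commute (x i) ?u"
      using x_far[of i] sub ik by (intro commute_mult) auto
    have ii: "invo (E (Suc i) (Suc k))" using a[of "Suc i"] sub ik by (simp del: icomm.simps)
    have "x i * E (Suc i) (Suc k) * x i = E i (Suc k) * E (Suc i) (Suc k)"
      using d[of i] sub ik by (simp del: icomm.simps)
    then have "E i (Suc k) = x i * E (Suc i) (Suc k) * x i * E (Suc i) (Suc k)"
      using ii by (simp del: icomm.simps add: mult.assoc invo_def)
    moreover have "commute ?u (x i * E (Suc i) (Suc k) * x i * E (Suc i) (Suc k))"
      using commute_sym[OF IH] commute_sym[OF xi] by (intro commute_mult)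
    ultimately show ?case unfolding \<open>E i (Suc k) = _\<close>[symmetric] by (simp only: commute_def)
  qed
  show ?thesis unfolding steinberg_upto_def
  proof (intro allI impI conjI ballI)
    fix i assume i: "i \<le> Suc k" "{i..Suc k} \<subseteq> P"
    show "invo (E i (Suc k))" using a i .
    show "commute (x j) (E i (Suc k))" if "j \<in> {i..Suc k}" for j using b[OF i] that by simp
    show "commute (E i (Suc k)) (x (Suc (Suc k)) * x (Suc k) * x (Suc (Suc k)))"
      if "i < Suc k" "Suc (Suc k) \<in> P"
    proof (rule e)
      have "{i..Suc (Suc k)} \<subseteq> insert (Suc (Suc k)) {i..Suc k}" by auto
      then show "{i..Suc (Suc k)} \<subseteq> P" using that(2) i(2) by blast
    qed (use that(1) in simp)
    show "x h * E i (Suc k) * x h = E h (Suc k) * E i (Suc k)" if "i = Suc h" "h \<in> P" for h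
    proof -
      have "{h..Suc k} \<subseteq> insert h {i..Suc k}" using that(1) by auto
      then have "{h..Suc k} \<subseteq> P" using that(2) i(2) by blast
      moreover have "h \<le> k" using that(1) i(1) by simp
      ultimately show ?thesis unfolding that(1) using d by blast
    qed
  qed
qed

lemma steinberg_upto: "steinberg_upto k"
proof (induction k)
  case 0
  then show ?case by (auto simp: steinberg_upto_def x_invo)
qed (rule steinberg_upto_Suc)

lemmas E_invo = steinberg_uptoD(1)[OF steinberg_upto]
lemmas x_E_commute = steinberg_uptoD(2)[OF steinberg_upto]

lemma x_E_conj:
  assumes "h < k" "{h..k} \<subseteq> P"
  shows "x h * E (Suc h) k * x h = E h k * E (Suc h) k"
proof -
  have "{Suc h..k} \<subseteq> P" "h \<in> P" "Suc h \<le> k" using assms by auto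
  then show ?thesis using steinberg_uptoD(4)[OF steinberg_upto, of "Suc h" k h] by simp
qed

lemma E_conj_commute:
  "h \<le> i \<Longrightarrow> i \<le> k \<Longrightarrow> {h..Suc k} \<subseteq> P \<Longrightarrow> commute (x (Suc k) * E h k * x (Suc k)) (E i k)"
  by (rule steinberg_conj_commute[OF steinberg_upto])

lemma x_E_far: 
  assumes "{i..k} \<subseteq> P" "i \<le> k" "j \<in> P" "Suc j < i \<or> Suc k < j"
  shows "commute (x j) (E i k)"
proof (rule icomm_commute)
  fix l assume l: "i \<le> l" "l \<le> k"
  then have "l \<in> P" using assms(1) by auto
  then show "commute (x j) (x l)" using x_far[of j l] x_far[of l j] l assms by (auto intro: commute_sym)
qed fact

lemma E_commute:
  assumes "{i..k} \<subseteq> P" "i \<le> k" "{j..k} \<subseteq> P" "j \<le> k"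
  shows "commute (E i k) (E j k)"
proof -
  have "commute (E i k) (E j k)" if "i \<le> j" "j \<le> k" "{i..k} \<subseteq> P" for i j
    using that by (intro icomm_commute commute_sym[OF x_E_commute]) auto
  from this[of i j] this[of j i] show ?thesis using assms commute_sym by (cases "i \<le> j") auto
qed

end

section \<open>One generator of the opposite kind\<close>

lemma pow_rot:
  assumes a: "invo a" and ab: "(a * b) ^ m = 1"
  shows "(b * a) ^ m = 1"
proof -
  have "(b * a) ^ m = a * (a * b) ^ m * a"
  proof (induction m)
    case 0
    then show ?case using a by (simp add: invo_def)
  next
    case (Suc m)
    then show ?case using a by (simp add: mult.assoc invo_left)
  qed
  then show ?thesis using a ab by (simp add: invo_def)
qed

text \<open>Reversing a word in involutions inverts it. With \<open>pow_rot\<close>, one relator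
  therefore yields all its cyclic shifts and reversals.\<close>

lemma pow_rev:
  assumes "invo a" "invo b" "invo c" and "(a * b * c) ^ m = 1"
  shows "(c * b * a) ^ m = 1"
proof -
  have "(c * b * a) * (a * b * c) = 1"
    using assms(1-3) by (simp add: mult.assoc invo_left) (simp add: invo_def)
  then have "(c * b * a) ^ m * (a * b * c) ^ m = 1" by (rule left_right_inverse_power)
  then show ?thesis using assms(4) by simp
qed

lemma pow3_braid:
  assumes a: "invo a" and y: "invo y" and ay: "(a * y)^3 = 1"
  shows "a * y * a = y * a * y"
proof -
  have "(a * y * a) * (y * a * y) = 1" using ay by (simp add: pow3 mult.assoc)
  then have "(a * y * a) * (y * a * y) * (y * a * y) = y * a * y" by simp
  moreover have "(y * a * y) * (y * a * y) = 1"
    using invo_conj[OF y a] by (simp add: invo_def)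
  ultimately show ?thesis by (metis mult.assoc mult_1_right)
qed

lemma pow4_flip:
  assumes a: "invo a" and b: "invo b" and ab: "(a * b)^4 = 1"
  shows "b * a * b * a = a * b * a * b"
  using pow4_commute_conj[OF assms] by (simp add: commute_def mult.assoc)

text \<open>Since y and b commute, (aby)^3 = 1 turns into a rule for rewriting ya; applying it moves
  y to the right until it cancels, and abab = baba finishes. For a = x_i, b = x_(i+1), y = y_i this
  is the Steinberg relation of y_i with the commutator of x_i and x_(i+1), and it is the entry point
  of the triple relations with exponent 3.\<close>

lemma pow3_triple:
  assumes a: "invo a" and b: "invo b" and y: "invo y" and yb: "commute y b"
    and ay: "(a * y)^3 = 1" and ab: "(a * b)^4 = 1" and aby: "(a * b * y)^3 = 1"
  shows "y * (a * (b * a * b)) * y = (a * (b * a * b)) * b"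
proof -
  have "a * b * y * (a * b * y) * (a * b * y) = 1" using aby by (simp add: pow3 mult.assoc)
  then have "a * (y * b) * a * (y * b) * a * (y * b) = 1"
    using yb by (simp add: commute_def mult.assoc)
  then have "y * a * (a * y * (b * a * (y * b) * a * (y * b))) = y * a" 
    by (simp add: mult.assoc)
  then have ya: "b * a * (y * b) * a * (y * b) = y * a"
    using a y by (simp add: mult.assoc invo_left)
  have "b * a * (y * b) * a * (y * b) = b * a * (b * y) * a * (y * b)"
    using yb by (simp add: commute_def)
  also have "\<dots> = b * a * b * (y * a * y) * b" by (simp add: mult.assoc)
  also have "\<dots> = b * a * b * (a * y * a) * b" by (simp only: pow3_braid[OF a y ay])
  finally have ya: "y * a = b * a * b * (a * y * a) * b" using ya by simp
  have "y * (a * (b * a * b)) * y = (y * a) * b * a * (b * y)" by (simp add: mult.assoc)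
  also have "b * y = y * b" using yb by (simp add: commute_def)
  also have "(y * a) * b * a * (y * b) = b * a * b * a * b"
    unfolding ya using a b y by (simp add: mult.assoc invo_left)
  also have "\<dots> = a * b * a * b * b" by (simp only: pow4_flip[OF a b ab])
  finally show ?thesis by (simp add: mult.assoc)
qed

text \<open>Only the mixed relations with two x and one y appear here; those with two y and one x
  come from a second instance with the roles exchanged.\<close>

locale unipotent_pair = unipotent x P for x :: "nat \<Rightarrow> 'g::monoid_mult" and P +
  fixes y :: "nat \<Rightarrow> 'g" and Q :: "nat set"
  assumes y_invo: "i \<in> Q \<Longrightarrow> invo (y i)"
    and xy_commute: "i \<in> P \<Longrightarrow> j \<in> Q \<Longrightarrow> i \<noteq> j \<Longrightarrow> commute (x i) (y j)"
    and xy_pow3: "i \<in> P \<Longrightarrow> i \<in> Q \<Longrightarrow> (x i * y i)^3 = 1"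
    and xxy_low: "i \<in> P \<Longrightarrow> Suc i \<in> P \<Longrightarrow> i \<in> Q \<Longrightarrow> (x i * x (Suc i) * y i)^3 = 1"
    and xxy_high: "i \<in> P \<Longrightarrow> Suc i \<in> P \<Longrightarrow> Suc i \<in> Q \<Longrightarrow> (x i * x (Suc i) * y (Suc i))^3 = 1"
begin

lemma y_E_outside:
  assumes "j \<in> Q" "{i..k} \<subseteq> P" "i \<le> k" "j < i \<or> k < j"
  shows "commute (y j) (E i k)"
proof (rule icomm_commute)
  fix l assume "i \<le> l" "l \<le> k"
  then have "l \<in> P" "l \<noteq> j" using assms by auto
  then show "commute (y j) (x l)" using xy_commute assms(1) by (intro commute_sym[OF xy_commute])
qed fact

text \<open>As a matrix, \<open>E i k\<close> adds coordinate i-1 to coordinate k, and y_i mixes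
  coordinate i into i-1; hence the extra factor. The case k = i+1 is \<open>pow3_triple\<close>, and
  the x added for larger k commute with y_i.\<close>

lemma y_E_first:
  assumes "{i..k} \<subseteq> P" "i < k" "i \<in> Q"
  shows "y i * E i k * y i = E i k * E (Suc i) k"
  using assms
proof (induction k)
  case (Suc k)
  let ?c = "x (Suc k)"
  have y: "invo (y i)" using Suc.prems by (simp add: y_invo)
  show ?case
  proof (cases "i = k")
    case True
    have P: "i \<in> P" "Suc i \<in> P" using Suc.prems by auto
    have "y i * (x i * (x (Suc i) * x i * x (Suc i))) * y i = (x i * (x (Suc i) * x i * x (Suc i))) * x (Suc i)"
      using P Suc.prems
      by (intro pow3_triple x_invo y_invo commute_sym[OF xy_commute] xy_pow3 x_pow4 xxy_low) auto
    then show ?thesis using True by simp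
  next
    case False
    then have ik: "Suc i \<le> k" "i \<le> k" using Suc.prems by auto
    have sub: "{i..k} \<subseteq> P" "Suc k \<in> P" "{i..Suc k} \<subseteq> P" "{Suc i..k} \<subseteq> P" using Suc.prems by auto
    note c = x_invo[OF sub(2)]
    let ?d = "E i k" and ?e = "E (Suc i) k"
    have IH: "y i * ?d * y i = ?d * ?e" using Suc ik sub by simp
    have yc: "y i * ?c * y i = ?c"
      using xy_commute[OF sub(2) Suc.prems(3)] ik y by (simp add: commute_conj_iff commute_sym)
    have cm: "commute ?e (?c * ?d * ?c)"
      using E_conj_commute[of i "Suc i" k] ik sub by (simp add: commute_sym)
    have "y i * (?d * (?c * ?d * ?c)) * y i = (y i * ?d * y i) * ((y i * ?c * y i) * (y i * ?d * y i) * (y i * ?c * y i))"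
      by (simp only: conj_mult[OF y])
    also have "\<dots> = ?d * (?e * (?c * ?d * ?c)) * (?c * ?e * ?c)"
      unfolding IH yc using c by (simp add: mult.assoc invo_left)
    also have "\<dots> = ?d * (?c * ?d * ?c) * (?e * (?c * ?e * ?c))"
      unfolding cm[unfolded commute_def] by (simp add: mult.assoc)
    finally show ?thesis unfolding E_Suc[OF ik(1)] E_Suc[OF ik(2)] .
  qed
qed simp

text \<open>\<open>icomm\<close> grows at its upper end; this form grows at the lower end, as
  descending inductions on i with fixed k require.\<close>

lemma E_conv_first:
  assumes "{i..k} \<subseteq> P" "i < k"
  shows "E i k = x i * E (Suc i) k * x i * E (Suc i) k"
proof -
  have "{Suc i..k} \<subseteq> P" "Suc i \<le> k" using assms by auto
  then have "invo (E (Suc i) k)" by (intro E_invo)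
  then show ?thesis unfolding x_E_conj[OF assms(2,1)] by (simp add: mult.assoc invo_def)
qed

lemma E_commute_shift:
  assumes "{i..Suc k} \<subseteq> P" "i < k"
  shows "commute (E i k) (E (Suc i) (Suc k))"
proof -
  have sub: "{Suc i..k} \<subseteq> P" "{i..k} \<subseteq> P" "Suc i \<le> k" using assms by auto
  have "commute (E i k) (E (Suc i) k)" using E_commute[of i k "Suc i"] sub assms by simp
  moreover have "commute (E i k) (x (Suc k) * E (Suc i) k * x (Suc k))"
  proof -
    have "Suc k \<in> P" using assms by auto
    have "commute (x (Suc k) * E i k * x (Suc k)) (E (Suc i) k)"
      using E_conj_commute[of i "Suc i" k] assms by simp
    then show ?thesis using x_invo[OF \<open>Suc k \<in> P\<close>] 
      by (metis commute_conj commute_sym)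
  qed
  ultimately show ?thesis unfolding E_Suc[OF sub(3)] by (rule commute_mult)
qed

text \<open>Counterpart of \<open>y_E_first\<close> at the target end: what
  \<open>E i (Suc k)\<close> adds to coordinate k+1 is passed on by y_(k+1) to coordinate k. The
  induction descends in i, because y_(k+1) commutes with x_i for i at most k but not with
  x_(k+1).\<close>

lemma y_E_last:
  assumes "{i..Suc k} \<subseteq> P" "i \<le> k" "Suc k \<in> Q"
  shows "y (Suc k) * E i (Suc k) * y (Suc k) = E i (Suc k) * E i k"
  using assms
proof (induction "k - i" arbitrary: i)
  case 0
  then have i: "i = k" by simp
  have P: "i \<in> P" "Suc i \<in> P" using 0 by auto
  let ?a = "x i" and ?b = "x (Suc i)" and ?y = "y (Suc i)"
  have inv: "invo ?a" "invo ?b" "invo ?y" using P 0 i by (simp_all add: x_invo y_invo)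
  have fl: "?b * ?a * ?b * ?a = ?a * ?b * ?a * ?b" using pow4_flip[OF inv(1,2) x_pow4] P .
  \<comment> \<open>\<open>pow3_triple\<close> is applied with the two x exchanged, so the relation
    is needed in the order b, a, y: reverse it, then rotate.\<close>
  have p: "(?b * ?a * ?y)^3 = 1"
    using pow_rot[OF inv(3), of "?b * ?a" 3] pow_rev[OF inv xxy_high] P 0 i by (simp add: mult.assoc)
  have "?y * (?b * (?a * ?b * ?a)) * ?y = (?b * (?a * ?b * ?a)) * ?a"
    using inv P 0 i p pow_rot[OF inv(1) x_pow4]
    by (intro pow3_triple xy_pow3 commute_sym[OF xy_commute]) auto
  moreover have "?b * (?a * ?b * ?a) = ?a * (?b * ?a * ?b)" using fl by (simp add: mult.assoc)
  ultimately have "?y * (?a * (?b * ?a * ?b)) * ?y = (?a * (?b * ?a * ?b)) * ?a" by (simp only:)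
  then show ?case unfolding i[symmetric] by simp
next
  case (Suc l)
  then have ik: "Suc i \<le> k" "i < Suc k" "Suc i < Suc k" by auto
  have sub: "{Suc i..Suc k} \<subseteq> P" "{i..k} \<subseteq> P" "{Suc i..k} \<subseteq> P" "i \<in> P" "Suc k \<in> P" using Suc.prems by auto
  let ?y = "y (Suc k)" and ?a = "x i" and ?D = "E (Suc i) (Suc k)" and ?D' = "E (Suc i) k"
  have y: "invo ?y" using Suc.prems by (simp add: y_invo)
  have a: "invo ?a" using sub by (simp add: x_invo)
  have IH: "?y * ?D * ?y = ?D * ?D'" using Suc ik sub by (simp del: icomm.simps)
  have ya: "?y * ?a * ?y = ?a"
    using xy_commute[of i "Suc k"] sub Suc.prems ik y by (simp add: commute_conj_iff commute_sym)
  have 1: "?a * ?D * ?a = E i (Suc k) * ?D" using x_E_conj[OF ik(2) Suc.prems(1)] .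
  have 2: "?a * ?D' * ?a = E i k * ?D'" using x_E_conj[of i k] ik sub by simp
  have cm: "commute ?D (E i k)" using E_commute_shift[OF Suc.prems(1)] ik by (simp del: icomm.simps add: commute_sym)
  have cm': "commute ?D' ?D" 
    unfolding E_Suc[OF ik(1)]
    using E_conj_commute[of "Suc i" "Suc i" k] sub ik
    by (intro commute_mult[OF commute_refl]) (simp add: commute_sym)
  have invD: "invo ?D" "invo ?D'" using E_invo sub ik by (simp_all del: icomm.simps)
  have "?y * E i (Suc k) * ?y = (?y * ?a * ?y) * (?y * ?D * ?y) * (?y * ?a * ?y) * (?y * ?D * ?y)"
    unfolding E_conv_first[OF Suc.prems(1) ik(2)] using y by (simp only: mult.assoc invo_left)
  also have "\<dots> = ?a * (?D * ?D') * ?a * (?D * ?D')" unfolding IH ya ..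
  also have "\<dots> = E i (Suc k) * ?D * (E i k * ?D') * (?D * ?D')" 
    unfolding conj_mult[OF a] 1 2 ..
  also have "\<dots> = E i (Suc k) * E i k * ?D * (?D' * ?D) * ?D'" 
    using cm by (simp only: mult.assoc commute_left)
  also have "?D' * ?D = ?D * ?D'" using cm' by (simp only: commute_def)
  also have "E i (Suc k) * E i k * ?D * (?D * ?D') * ?D' = E i (Suc k) * E i k"
    using invD by (simp only: mult.assoc invo_left) (simp only: invo_def mult_1_right)
  finally show ?case .
qed

text \<open>The interval grows from {j-1..j+1}, first downwards and then upwards, and every added x
  commutes with y_j. In the shortest case \<open>y_E_last\<close> produces a factor x_i in each of
  two places, and the two cancel.\<close>

lemma y_E_inner:
  assumes "{i..k} \<subseteq> P" "i < j" "j < k" "j \<in> Q"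
  shows "commute (y j) (E i k)"
proof -
  have base: "commute (y (Suc i)) (E i (Suc (Suc i)))"
    if P: "i \<in> P" "Suc i \<in> P" "Suc (Suc i) \<in> P" and Q: "Suc i \<in> Q" for i
  proof -
    let ?y = "y (Suc i)" and ?c = "x (Suc (Suc i))" and ?d = "E i (Suc i)" and ?a = "x i"
    note y = y_invo[OF Q] and a = x_invo[OF P(1)] and c = x_invo[OF P(3)]
    have sub: "{i..Suc i} \<subseteq> P" using P by (auto simp: le_Suc_eq)
    have yd: "?y * ?d * ?y = ?d * ?a" using y_E_last[OF sub _ Q] by (simp del: icomm.simps)
    have yc: "?y * ?c * ?y = ?c" using xy_commute[OF P(3) Q] y by (simp add: commute_conj_iff commute_sym)
    have ac: "commute ?a ?c" using x_far P by simp
    have "commute ?a (?d * (?c * ?d * ?c))"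
      using x_E_commute[OF _ sub, of i] ac by (intro commute_mult) (simp_all del: icomm.simps)
    note ad = commute_left[OF this] this
    have e: "E i (Suc (Suc i)) = ?d * (?c * ?d * ?c)" by (subst E_Suc) (simp_all del: icomm.simps)
    have "?y * (?d * (?c * ?d * ?c)) * ?y = (?y * ?d * ?y) * ((?y * ?c * ?y) * (?y * ?d * ?y) * (?y * ?c * ?y))"
      by (simp only: conj_mult[OF y])
    also have "\<dots> = ?d * (?a * ?c) * ?d * (?a * ?c)" unfolding yd yc by (simp only: mult.assoc)
    also have "\<dots> = ?d * (?c * (?a * ?d)) * (?c * ?a)" using ac unfolding commute_def by (simp only: mult.assoc)
    also have "?a * ?d = ?d * ?a" using x_E_commute[OF _ sub, of i] by (simp del: icomm.simps add: commute_def)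
    also have "?d * (?c * (?d * ?a)) * (?c * ?a) = ?d * (?c * ?d * (?a * ?c) * ?a)" by (simp only: mult.assoc)
    also have "?a * ?c = ?c * ?a" using ac by (simp only: commute_def)
    also have "?d * (?c * ?d * (?c * ?a) * ?a) = ?d * (?c * ?d * ?c)"
      using a unfolding invo_def by (simp only: mult.assoc mult_1_right)
    finally show ?thesis unfolding e commute_conj_iff[OF y] .
  qed
  have first: "commute (y j) (E i (Suc j))"
    if "{i..Suc j} \<subseteq> P" "i < j" "j \<in> Q" for i j
    using that
  proof (induction "j - i" arbitrary: i)
    case (Suc l)
    show ?case
    proof (cases "j = Suc i")
      case True
      moreover have "i \<in> P" "Suc i \<in> P" "Suc (Suc i) \<in> P" using True Suc.prems by auto
      ultimately show ?thesis using base[of i] Suc.prems by (simp del: icomm.simps)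
    next
      case False
      then have ij: "Suc i < j" "i < Suc j" using Suc.prems by auto
      have sub: "{Suc i..Suc j} \<subseteq> P" "i \<in> P" using Suc.prems by auto
      have "commute (y j) (E (Suc i) (Suc j))" using Suc sub ij by (simp del: icomm.simps)
      moreover have "commute (y j) (x i)" using xy_commute[of i j] sub Suc.prems by (simp add: commute_sym)
      ultimately show ?thesis unfolding E_conv_first[OF Suc.prems(1) ij(2)] by (intro commute_mult)
    qed
  qed simp
  show ?thesis using assms
  proof (induction k)
    case (Suc k)
    show ?case
    proof (cases "j = k")
      case True
      then show ?thesis using first Suc.prems by (simp del: icomm.simps)
    next
      case False
      then have jk: "j < k" "i \<le> k" using Suc.prems by auto
      have sub: "{i..k} \<subseteq> P" "Suc k \<in> P" using Suc.prems jk by auto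
      have "commute (y j) (E i k)" using Suc jk sub by simp
      moreover have "commute (y j) (x (Suc k))" using xy_commute[OF sub(2) Suc.prems(4)] jk by (simp add: commute_sym)
      ultimately show ?thesis unfolding E_Suc[OF jk(2)] by (intro commute_mult)
    qed
  qed simp
qed

end

section \<open>Two double cosets\<close>

declare icomm.simps(2) [simp del]

text \<open>All generating sets used below consist of involutions, so these submonoids are subgroups
  (\<open>span_inverse\<close>). Words grow on the right, which fits the closure of the cells under
  right multiplication.\<close>

inductive_set span :: "'g::monoid_mult set \<Rightarrow> 'g set" for A where
  span_one: "1 \<in> span A"
| span_step: "g \<in> span A \<Longrightarrow> a \<in> A \<Longrightarrow> g * a \<in> span A"

lemma span_base: "a \<in> A \<Longrightarrow> a \<in> span A"
  using span_step[OF span_one] by force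

lemma span_mult: "h \<in> span A \<Longrightarrow> g \<in> span A \<Longrightarrow> g * h \<in> span A"
  by (induction h rule: span.induct) (auto simp flip: mult.assoc intro: span_step)

lemma span_mono: "g \<in> span A \<Longrightarrow> A \<subseteq> B \<Longrightarrow> g \<in> span B"
  by (induction g rule: span.induct) (auto intro: span_one span_step)

lemma span_commute: "g \<in> span A \<Longrightarrow> (\<And>a. a \<in> A \<Longrightarrow> commute z a) \<Longrightarrow> commute z g"
  by (induction g rule: span.induct) (auto intro: commute_mult)

lemma span_inverse:
  "g \<in> span A \<Longrightarrow> (\<And>a. a \<in> A \<Longrightarrow> invo a) \<Longrightarrow> \<exists>h\<in>span A. g * h = 1 \<and> h * g = 1"
proof (induction g rule: span.induct)
  case (span_step g a)
  then obtain h where h: "h \<in> span A" "g * h = 1" "h * g = 1" by auto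
  have "g * a * (a * h) = 1" 
    using h span_step by (simp add: mult.assoc invo_left)
  moreover have "a * h * (g * a) = 1"
  proof -
    have "a * h * (g * a) = a * (h * g) * a" by (simp only: mult.assoc)
    then show ?thesis using h span_step by (simp add: invo_def)
  qed
  moreover have "a * h \<in> span A" using h span_step by (simp add: span_mult span_base)
  ultimately show ?case by blast
qed (auto intro: span_one)

text \<open>The occurrences of e can be collected in front, where they cancel in pairs.\<close>

lemma span_insert:
  assumes "g \<in> span (insert e A)" "\<And>a. a \<in> A \<Longrightarrow> commute e a" "invo e"
  shows "\<exists>h\<in>span A. g = h \<or> g = e * h"
  using assms(1)
proof (induction g rule: span.induct)
  case (span_step g a)
  then obtain h where h: "h \<in> span A" "g = h \<or> g = e * h" by auto
  show ?case
  proof (cases "a = e")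
    case True
    have "commute e h" using span_commute[OF h(1) assms(2)] .
    then have "e * h * e = h" using commute_conj_iff[OF assms(3)] by blast
    moreover have "h * e = e * h" using \<open>commute e h\<close> by (simp add: commute_def)
    ultimately show ?thesis using h True by auto
  next
    case False
    then have "h * a \<in> span A" using h(1) span_step by (auto intro: span.span_step)
    then show ?thesis using h(2) by (auto simp: mult.assoc)
  qed
qed (auto intro: span_one)

lemma span_normal:
  assumes "\<And>a b. a \<in> A \<Longrightarrow> b \<in> B \<Longrightarrow> a * b * a \<in> span B" "\<And>a. a \<in> A \<Longrightarrow> invo a"
    and "g \<in> span A" "r \<in> span B"
  shows "\<exists>r'\<in>span B. r * g = g * r'" "\<exists>r'\<in>span B. g * r = r' * g"
proof -
  have conj: "a * r * a \<in> span B" if "a \<in> A" "r \<in> span B" for a r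
    using that(2)
  proof (induction r rule: span.induct)
    case span_one
    then show ?case using assms(2)[OF that(1)] by (simp add: invo_def span.span_one)
  next
    case (span_step r b)
    then show ?case
      using conj_mult[OF assms(2)[OF that(1)]] assms(1)[OF that(1)] by (simp add: span_mult)
  qed
  show "\<exists>r'\<in>span B. r * g = g * r'"
    using assms(3)
  proof (induction g rule: span.induct)
    case (span_step g a)
    then obtain r' where r': "r' \<in> span B" "r * g = g * r'" by auto
    have "g * a * (a * r' * a) = g * r' * a"
      using assms(2)[OF span_step(2)] by (simp add: mult.assoc invo_left)
    moreover have "r * (g * a) = g * r' * a" using r'(2) by (simp flip: mult.assoc)
    ultimately have "r * (g * a) = g * a * (a * r' * a)" by (simp only:)
    then show ?case using conj[OF span_step(2) r'(1)] by blast
  qed (use assms(4) in auto)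
  show "\<exists>r'\<in>span B. g * r = r' * g"
    using assms(3,4)
  proof (induction g arbitrary: r rule: span.induct)
    case (span_step g a)
    from span_step(3)[OF conj[OF span_step(2,4)]]
    obtain r' where r': "r' \<in> span B" "g * (a * r * a) = r' * g" by blast
    have "g * a * r = g * (a * r * a) * a"
      using assms(2)[OF span_step(2)] by (simp add: mult.assoc invo_def)
    also have "\<dots> = r' * (g * a)" unfolding r'(2) by (simp only: mult.assoc)
    finally have "g * a * r = r' * (g * a)" .
    then show ?case using r' by blast
  qed auto
qed

section \<open>Row and column subgroups\<close>

definition gens :: "(nat \<Rightarrow> 'g) \<Rightarrow> nat set \<Rightarrow> (nat \<Rightarrow> 'g) \<Rightarrow> nat set \<Rightarrow> nat \<Rightarrow> 'g set" where
  "gens x P y Q k = {x i | i. i \<in> P \<and> i \<le> k} \<union> {y i | i. i \<in> Q \<and> i \<le> k}"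

lemma gens_swap: "gens x P y Q k = gens y Q x P k"
  by (auto simp: gens_def)

text \<open>Generators of row k for x and of column k for y. The set is empty when k is not in
  P.\<close>

definition top_root :: "(nat \<Rightarrow> 'g::monoid_mult) \<Rightarrow> nat set \<Rightarrow> nat \<Rightarrow> 'g set" where
  "top_root x P k = {icomm x i k | i. i \<le> k \<and> {i..k} \<subseteq> P}"

locale A2 = X: unipotent_pair x P y Q + Y: unipotent_pair y Q x P
  for x :: "nat \<Rightarrow> 'g::monoid_mult" and P y Q
begin

text \<open>Interpreting the locale a second time through this lemma transfers every statement about
  \<open>R\<close> to \<open>C\<close>.\<close>

lemma swap: "A2 y Q x P"
  by unfold_locales

abbreviation "G k \<equiv> span (gens x P y Q k)"
abbreviation "R k \<equiv> span (top_root x P (Suc k))"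
abbreviation "C k \<equiv> span (top_root y Q (Suc k))"

lemma gens_invo: "a \<in> gens x P y Q k \<Longrightarrow> invo a"
  by (auto simp: gens_def X.x_invo Y.x_invo)

lemma x_in_G: "i \<in> P \<Longrightarrow> i \<le> k \<Longrightarrow> x i \<in> G k" and y_in_G: "i \<in> Q \<Longrightarrow> i \<le> k \<Longrightarrow> y i \<in> G k"
  by (auto simp: gens_def intro!: span_base)

lemma E_in_G: "i \<le> j \<Longrightarrow> {i..j} \<subseteq> P \<Longrightarrow> j \<le> k \<Longrightarrow> X.E i j \<in> G k"
proof (induction j)
  case (Suc j)
  have s: "Suc j \<in> P" using Suc.prems by auto
  show ?case
  proof (cases "i \<le> j")
    case True
    have "{i..j} \<subseteq> P" using Suc.prems by auto
    then show ?thesis unfolding X.E_Suc[OF True]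
      using Suc True s by (intro span_mult x_in_G) auto
  next
    case False
    then have "i = Suc j" using Suc by simp
    then show ?thesis using s Suc.prems by (simp del: icomm.simps add: x_in_G)
  qed
qed (auto intro: x_in_G)

text \<open>The generators of \<open>G k\<close> have index at most k, so the case
  \<open>y_E_last\<close>, whose extra factor leaves \<open>R k\<close>, does not arise. The
  remaining cases are exactly the Steinberg relations proved above.\<close>

lemma R_normal_gen:
  assumes a: "a \<in> gens x P y Q k" and e: "e \<in> top_root x P (Suc k)"
  shows "a * e * a \<in> R k"
proof -
  obtain i where e: "e = X.E i (Suc k)" and i: "i \<le> Suc k" "{i..Suc k} \<subseteq> P"
    using e by (auto simp: top_root_def)
  have mem: "X.E j (Suc k) \<in> R k" if "j \<le> Suc k" "{j..Suc k} \<subseteq> P" for j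
    using that by (intro span_base) (auto simp: top_root_def)
  note inv = gens_invo[OF a]
  have c: "?thesis" if "commute a e" 
  proof -
    have "a * e * a = e" using that commute_conj_iff[OF inv] by blast
    then show ?thesis using mem[OF i] e by simp
  qed
  from a consider (x) j where "a = x j" "j \<in> P" "j \<le> k" | (y) j where "a = y j" "j \<in> Q" "j \<le> k"
    by (auto simp: gens_def)
  then show ?thesis
  proof cases
    case x
    consider "i \<le> j" | "Suc j = i" | "Suc j < i" by linarith
    then show ?thesis
    proof cases
      case 1
      then show ?thesis using c X.x_E_commute[OF i, of j] x e by simp
    next
      case 2
      have "{j..Suc k} \<subseteq> insert j {i..Suc k}" using 2 by auto
      then have "{j..Suc k} \<subseteq> P" using i x by blast
      then show ?thesis using X.x_E_conj[of j "Suc k"] mem[of j] mem[OF i] 2 x e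
        by (simp del: icomm.simps add: span_mult)
    next
      case 3
      then show ?thesis using c X.x_E_far[OF i(2,1) x(2)] x e by simp
    qed
  next
    case y
    consider "j < i" | "j = i" | "i < j" by linarith
    then show ?thesis
    proof cases
      case 1
      then show ?thesis using c X.y_E_outside[OF y(2) i(2,1)] y e by simp
    next
      case 2
      have "{Suc i..Suc k} \<subseteq> P" using i by auto
      then show ?thesis using X.y_E_first[OF i(2)] mem[of "Suc i"] mem[OF i] 2 y e
        by (simp del: icomm.simps add: span_mult)
    next
      case 3
      then show ?thesis using c X.y_E_inner[OF i(2) 3] y e by simp
    qed
  qed
qed

lemma R_normal:
  assumes "g \<in> G k" "r \<in> R k"
  shows "\<exists>r'\<in>R k. r * g = g * r'" "\<exists>r'\<in>R k. g * r = r' * g"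
  by (rule span_normal[OF R_normal_gen gens_invo assms]; assumption)+

text \<open>x_(k+1) is split off because w carries it to y_(k+1), while the rest of row k+1 is
  carried into \<open>G k\<close>.\<close>

lemma R_split:
  assumes "r \<in> R k"
  shows "\<exists>r'\<in>span (top_root x P (Suc k) - {x (Suc k)}). r = r' \<or> (Suc k \<in> P \<and> r = x (Suc k) * r')"
proof (cases "Suc k \<in> P")
  case True
  have "top_root x P (Suc k) \<subseteq> insert (x (Suc k)) (top_root x P (Suc k) - {x (Suc k)})" by auto
  from span_insert[OF span_mono[OF assms this] _ X.x_invo[OF True]]
  show ?thesis using True X.x_E_commute[where j = "Suc k"] by (auto simp: top_root_def simp del: icomm.simps)
next
  case False
  then have "top_root x P (Suc k) = {}" by (auto simp: top_root_def)
  then show ?thesis using assms by auto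
qed


lemma G_mult: "g \<in> G k \<Longrightarrow> h \<in> G k \<Longrightarrow> g * h \<in> G k"
  by (rule span_mult)

text \<open>The left factor G_k C common to both cells. It is closed under products because
  \<open>G k\<close> normalises \<open>C k\<close>.\<close>

definition K :: "nat \<Rightarrow> 'g set" where
  "K k = {h * c | h c. h \<in> G k \<and> c \<in> C k}"

lemma C_normal:
  assumes "g \<in> G k" "c \<in> C k"
  shows "\<exists>c'\<in>C k. c * g = g * c'"
proof -
  interpret S: A2 y Q x P by (rule swap)
  show ?thesis using S.R_normal(1)[unfolded gens_swap[of y]] assms by blast
qed

lemma G_subset_K: "g \<in> G k \<Longrightarrow> g \<in> K k"
  unfolding K_def using mult_1_right[of g] span_one by (metis (mono_tags, lifting) mem_Collect_eq)

lemma C_subset_K: "c \<in> C k \<Longrightarrow> c \<in> K k"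
  unfolding K_def using mult_1_left[of c] span_one by (metis (mono_tags, lifting) mem_Collect_eq)

lemma K_mult: 
  assumes "a \<in> K k" "b \<in> K k"
  shows "a * b \<in> K k"
proof -
  obtain g c g' c' where a: "a = g * c" "g \<in> G k" "c \<in> C k" and b: "b = g' * c'" "g' \<in> G k" "c' \<in> C k"
    using assms unfolding K_def by blast
  obtain c'' where c: "c'' \<in> C k" "c * g' = g' * c''" using C_normal[OF b(2) a(3)] by blast
  have "a * b = g * (c * g') * c'" using a b by (simp add: mult.assoc)
  also have "\<dots> = (g * g') * (c'' * c')" using c by (simp add: mult.assoc)
  finally show ?thesis using a b c unfolding K_def by (blast intro: span_mult)
qed

context
  fixes k
  assumes P: "Suc k \<in> P" and Q: "Suc k \<in> Q"
begin

abbreviation "xs \<equiv> x (Suc k)"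
abbreviation "ys \<equiv> y (Suc k)"
abbreviation "w \<equiv> xs * ys * xs"

lemma xs: "xs * xs = 1" "xs * (xs * z) = z" and ys: "ys * ys = 1" "ys * (ys * z) = z"
  using X.x_invo[OF P] Y.x_invo[OF Q] by (simp_all add: invo_left) (simp_all add: invo_def)

lemma w_alt: "w = ys * xs * ys"
  by (rule pow3_braid[OF X.x_invo[OF P] X.y_invo[OF Q] X.xy_pow3[OF P Q]])

lemma w_x: "w * xs = ys * w"
proof -
  have "ys * w = xs * ys" unfolding w_alt by (simp add: mult.assoc ys)
  then show ?thesis by (simp add: mult.assoc xs)
qed

lemma w_y: "w * ys = xs * w"
proof -
  have "w * ys = ys * xs" unfolding w_alt by (simp add: mult.assoc ys)
  then show ?thesis by (simp add: mult.assoc xs)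
qed

text \<open>w stands for the transposition of coordinates k and k+1, so row k+1 turns into row k.
  Here this is derived from relations alone, by pushing \<open>E i (Suc k)\<close> through the three
  letters of w = yxy.\<close>

lemma w_E:
  assumes i: "i \<le> k" "{i..Suc k} \<subseteq> P"
  shows "w * X.E i (Suc k) = X.E i k * w"
proof -
  let ?E = "X.E i (Suc k)" and ?D = "X.E i k"
  have sub: "{i..k} \<subseteq> P" using i by auto
  have yE: "ys * ?E = ?E * ?D * ys"
    using X.y_E_last[OF i(2,1) Q] conj_swap[OF Y.x_invo[OF Q]] by blast
  have yD: "ys * ?D = ?D * ys"
    using X.y_E_outside[OF Q sub i(1)] by (simp add: commute_def)
  have E: "?E = ?D * (xs * ?D * xs)" by (rule X.E_Suc[OF i(1)])
  have D: "?D * (?D * z) = z" for z using invo_left[OF X.E_invo[OF i(1) sub]] .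

  have "commute (xs * ?D * xs) ?D" using X.E_conj_commute[OF order_refl i] .
  then have "?E = xs * ?D * xs * ?D" unfolding E by (simp add: commute_def)
  then have xED: "xs * ?E * ?D = ?D * xs" using D[of 1] by (simp add: mult.assoc xs)
  have "w * ?E = ys * xs * (ys * ?E)" unfolding w_alt by (simp add: mult.assoc)
  also have "\<dots> = ys * (xs * ?E * ?D) * ys" unfolding yE by (simp add: mult.assoc)
  also have "\<dots> = (ys * ?D) * xs * ys" unfolding xED by (simp add: mult.assoc)
  also have "\<dots> = ?D * w" unfolding yD w_alt by (simp add: mult.assoc)
  finally show ?thesis .
qed

lemma w_R':
  assumes "r \<in> span (top_root x P (Suc k) - {xs})"
  shows "\<exists>h\<in>G k. w * r = h * w"
  using assms
proof (induction r rule: span.induct)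
  case span_one
  then show ?case by (auto intro!: bexI[of _ 1] span.span_one)
next
  case (span_step r e)
  then obtain h where h: "h \<in> G k" "w * r = h * w" by blast
  obtain i where e: "e = X.E i (Suc k)" "i \<le> Suc k" "{i..Suc k} \<subseteq> P" "e \<noteq> xs"
    using span_step(2) by (auto simp: top_root_def)
  have i: "i \<le> k" using e by (cases "i = Suc k") auto
  have "w * (r * e) = (w * r) * e" by (simp only: mult.assoc)
  also have "\<dots> = h * (w * e)" unfolding h(2) by (simp only: mult.assoc)
  also have "\<dots> = h * X.E i k * w" unfolding e(1) w_E[OF i e(3)] by (simp only: mult.assoc)
  finally have "w * (r * e) = h * X.E i k * w" .
  moreover have "{i..k} \<subseteq> P" using e(3) by auto
  then have "h * X.E i k \<in> G k" using h(1) i by (intro G_mult E_in_G) auto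
  ultimately show ?case by blast
qed

text \<open>y_(k+1) does not normalise \<open>R k\<close>: passing \<open>E i (Suc k)\<close>
  creates the extra factor \<open>E i k\<close>. That factor lies in \<open>G k\<close>, so
  normality of \<open>R k\<close> lets it move to the front.\<close>

lemma y_R':
  assumes "r \<in> span (top_root x P (Suc k) - {xs})"
  shows "\<exists>g\<in>G k. \<exists>r'\<in>R k. r * ys = ys * (g * r')"
  using assms
proof (induction r rule: span.induct)
  case span_one
  then show ?case by (intro bexI[of _ 1]) (auto intro: span.span_one)
next
  case (span_step r e)
  then obtain g r' where h: "g \<in> G k" "r' \<in> R k" "r * ys = ys * (g * r')" by blast
  obtain i where e: "e = X.E i (Suc k)" "i \<le> Suc k" "{i..Suc k} \<subseteq> P" "e \<noteq> xs"
    using span_step(2) by (auto simp: top_root_def)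
  have i: "i \<le> k" using e by (cases "i = Suc k") auto
  have sub: "{i..k} \<subseteq> P" using e(3) by auto
  let ?D = "X.E i k"
  have D: "?D \<in> G k" using i sub by (intro E_in_G) auto
  have eR: "e \<in> R k" using span_step(2) by (auto intro: span_base)
  have "ys * e * ys = e * ?D"
    unfolding e(1) using X.y_E_last[OF e(3) i Q] .
  then have eD: "e * ys = ys * (e * ?D)" using ys(2)[of "e * ys"] by (simp add: mult.assoc)
  obtain r'' where r'': "r'' \<in> R k" "(r' * e) * ?D = ?D * r''"
    using R_normal(1)[OF D span_mult[OF eR h(2)]] by blast
  have "r * e * ys = (r * ys) * (e * ?D)" using eD by (simp only: mult.assoc)
  also have "\<dots> = ys * (g * ((r' * e) * ?D))" unfolding h(3) by (simp only: mult.assoc)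
  also have "\<dots> = ys * ((g * ?D) * r'')" unfolding r''(2) by (simp only: mult.assoc)
  finally show ?case using r''(1) G_mult[OF h(1) D] by blast
qed

text \<open>The factor x_(k+1) becomes y_(k+1), which lies in \<open>C k\<close>, and the other
  factors pass into \<open>G k\<close>; both are parts of \<open>K k\<close>.\<close>

lemma w_R:
  assumes "r \<in> R k"
  shows "\<exists>\<kappa>\<in>K k. w * r = \<kappa> * w"
proof -
  obtain r' where r': "r' \<in> span (top_root x P (Suc k) - {xs})" "r = r' \<or> r = xs * r'"
    using R_split[OF assms] by blast
  obtain h where h: "h \<in> G k" "w * r' = h * w" using w_R'[OF r'(1)] by blast
  have "ys \<in> K k" using Q by (intro C_subset_K span_base) (force simp: top_root_def)
  then have "ys * h \<in> K k" using G_subset_K[OF h(1)] by (rule K_mult)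
  moreover have "w * (xs * r') = ys * h * w"
  proof -
    have "w * (xs * r') = w * xs * r'" by (simp only: mult.assoc)
    also have "\<dots> = ys * (w * r')" unfolding w_x by (simp only: mult.assoc)
    also have "\<dots> = ys * h * w" unfolding h(2) by (simp only: mult.assoc)
    finally show ?thesis .
  qed
  ultimately show ?thesis using r'(2) h G_subset_K by blast
qed

end

text \<open>By \<open>w_alt\<close>, w is its own mirror image, so the column case follows from
  \<open>w_R'\<close>. A factor y_(k+1) becomes x_(k+1), which need not lie in \<open>K k\<close>
  and is therefore left standing next to w.\<close>

lemma w_C':
  assumes P: "Suc k \<in> P" and Q: "Suc k \<in> Q" and "c \<in> C k"
  shows "\<exists>h\<in>G k. w k * c = h * w k \<or> w k * c = h * (xs k * w k)"
proof -
  interpret S: A2 y Q x P by (rule swap)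
  obtain c' where c': "c' \<in> span (top_root y Q (Suc k) - {ys k})" "c = c' \<or> c = ys k * c'"
    using S.R_split[OF assms(3)] by blast
  obtain h where h: "h \<in> G k" "w k * c' = h * w k"
    using S.w_R'[OF Q P c'(1)] unfolding gens_swap[of y] w_alt[OF P Q, symmetric] by blast
  have cc: "commute (ys k) c'"
    using c'(1) 
  proof (rule span_commute)
    fix a assume "a \<in> top_root y Q (Suc k) - {ys k}"
    then show "commute (ys k) a" using Y.x_E_commute[where j = "Suc k"] by (auto simp: top_root_def)
  qed
  have "w k * (c' * ys k) = (w k * c') * ys k" by (simp only: mult.assoc)
  also have "\<dots> = h * (w k * ys k)" unfolding h(2) by (simp only: mult.assoc)
  also have "\<dots> = h * (xs k * w k)" unfolding w_y[OF P Q] ..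
  also have "c' * ys k = ys k * c'" using cc by (simp only: commute_def)
  finally show ?thesis using c'(2) h by blast
qed

section \<open>Closure of the two cells under the generators\<close>

definition cells :: "nat \<Rightarrow> 'g set" where
  "cells k = {\<kappa> * r | \<kappa> r. \<kappa> \<in> K k \<and> r \<in> R k} \<union>
     {\<kappa> * w k * h | \<kappa> h. \<kappa> \<in> K k \<and> h \<in> G k \<and> Suc k \<in> P \<and> Suc k \<in> Q}"

lemma cellsE:
  assumes "a \<in> cells k"
  obtains \<kappa> r where "a = \<kappa> * r" "\<kappa> \<in> K k" "r \<in> R k"
  | \<kappa> h where "a = \<kappa> * w k * h" "\<kappa> \<in> K k" "h \<in> G k" "Suc k \<in> P" "Suc k \<in> Q"
  using assms unfolding cells_def by blast

lemma cells_KR: "\<kappa> \<in> K k \<Longrightarrow> r \<in> R k \<Longrightarrow> \<kappa> * r \<in> cells k"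
  and cells_KwG: "Suc k \<in> P \<Longrightarrow> Suc k \<in> Q \<Longrightarrow> \<kappa> \<in> K k \<Longrightarrow> h \<in> G k \<Longrightarrow> \<kappa> * w k * h \<in> cells k"
  unfolding cells_def by blast+

lemma cells_G:
  assumes "a \<in> cells k" "g \<in> G k"
  shows "a * g \<in> cells k"
  using assms(1)
proof (cases rule: cellsE)
  case a: (1 \<kappa> r)
  obtain r' where r': "r' \<in> R k" "r * g = g * r'" using R_normal(1)[OF assms(2) a(3)] by blast
  have "a * g = (\<kappa> * g) * r'" unfolding a(1) mult.assoc r'(2) ..
  then show ?thesis using cells_KR[OF K_mult[OF a(2) G_subset_K[OF assms(2)]] r'(1)] by simp
next
  case a: (2 \<kappa> h)
  then have "\<kappa> * w k * (h * g) \<in> cells k" using assms(2) by (intro cells_KwG G_mult)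
  then show ?thesis using a by (simp add: mult.assoc)
qed

lemma cells_K:
  assumes "a \<in> cells k" "\<kappa> \<in> K k"
  shows "\<kappa> * a \<in> cells k"
  using assms(1)
proof (cases rule: cellsE)
  case a: (1 \<kappa>' r)
  then show ?thesis using cells_KR[OF K_mult[OF assms(2)]] by (simp add: mult.assoc)
next
  case a: (2 \<kappa>' h)
  then show ?thesis using cells_KwG[OF _ _ K_mult[OF assms(2)]] by (simp add: mult.assoc)
qed

lemma one_K: "1 \<in> K k"
  by (rule G_subset_K[OF span_one])

lemma cells_w:
  assumes "Suc k \<in> P" "Suc k \<in> Q" "r \<in> R k" "h \<in> G k"
  shows "w k * r * h \<in> cells k"
proof -
  obtain \<kappa> where \<kappa>: "\<kappa> \<in> K k" "w k * r = \<kappa> * w k" using w_R[OF assms(1-3)] by blast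
  show ?thesis unfolding \<kappa>(2) by (rule cells_KwG[OF assms(1,2) \<kappa>(1) assms(4)])
qed

lemma y_K: "Suc k \<in> Q \<Longrightarrow> y (Suc k) \<in> K k"
  by (intro C_subset_K span_base) (force simp: top_root_def)

lemma x_R: "Suc k \<in> P \<Longrightarrow> x (Suc k) \<in> R k"
  by (intro span_base) (force simp: top_root_def)

lemma cells_x:
  assumes "a \<in> cells k" and P: "Suc k \<in> P"
  shows "a * x (Suc k) \<in> cells k"
  using assms(1)
proof (cases rule: cellsE)
  case a: (1 \<kappa> r)
  then show ?thesis using cells_KR[OF a(2) span_mult[OF x_R[OF P] a(3)]] by (simp add: mult.assoc)
next
  case a: (2 \<kappa> h)
  obtain r where r: "r \<in> R k" "h * x (Suc k) = r * h" using R_normal(2)[OF a(3) x_R[OF P]] by blast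
  have "a * x (Suc k) = \<kappa> * (w k * (h * x (Suc k)))" unfolding a(1) by (simp only: mult.assoc)
  also have "\<dots> = \<kappa> * (w k * r * h)" unfolding r(2) by (simp only: mult.assoc)
  finally show ?thesis using cells_K[OF cells_w[OF a(4,5) r(1) a(3)] a(2)] by simp
qed

lemma cells_y:
  assumes "a \<in> cells k" and Q: "Suc k \<in> Q"
  shows "a * y (Suc k) \<in> cells k"
  using assms(1)
proof (cases rule: cellsE)
  case a: (1 \<kappa> r)
  obtain r' where r': "r' \<in> span (top_root x P (Suc k) - {xs k})" 
    "r = r' \<or> Suc k \<in> P \<and> r = x (Suc k) * r'"
    using R_split[OF a(3)] by blast
  show ?thesis
  proof (cases "Suc k \<in> P")
    case P: True
    obtain g r'' where g: "g \<in> G k" "r'' \<in> R k" "r' * ys k = ys k * (g * r'')"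
      using y_R'[OF P Q r'(1)] by blast
    have 1: "r' * ys k \<in> cells k"
      unfolding g(3) using cells_KR[OF K_mult[OF y_K[OF Q] G_subset_K[OF g(1)]] g(2)]
      by (simp only: mult.assoc)
    obtain r3 where r3: "r3 \<in> R k" "g * r'' = r3 * g" using R_normal(2)[OF g(1,2)] by blast
    \<comment> \<open>Here the product leaves the first cell: x y is rewritten as y w, and y belongs
      to \<open>K k\<close>.\<close>
    have xy: "xs k * ys k = ys k * w k" using w_alt[OF P Q] ys[OF P Q] by (simp add: mult.assoc)
    have "xs k * r' * ys k = xs k * ys k * (g * r'')" using g(3) by (simp only: mult.assoc)
    also have "\<dots> = ys k * w k * (r3 * g)" by (simp only: xy[symmetric] r3(2))
    also have "\<dots> = ys k * (w k * r3 * g)" by (simp only: mult.assoc)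
    finally have 2: "xs k * r' * ys k \<in> cells k"
      using cells_K[OF cells_w[OF P Q r3(1) g(1)] y_K[OF Q]] by simp
    have "r * ys k \<in> cells k" using r'(2) 1 2 by (auto simp: mult.assoc)
    then show ?thesis using cells_K[OF _ a(2)] unfolding a(1) by (simp add: mult.assoc)
  next
    case False
    then have "top_root x P (Suc k) = {}" by (auto simp: top_root_def)
    then have "r = 1" using a(3) by (auto elim: span.cases)
    then show ?thesis using cells_KR[OF K_mult[OF a(2) y_K[OF Q]] span_one] a(1) by simp
  qed
next
  case a: (2 \<kappa> h)
  note P = a(4)
  interpret S: A2 y Q x P by (rule swap)
  obtain c where c: "c \<in> C k" "h * ys k = c * h"
    using S.R_normal(2)[unfolded gens_swap[of y], OF a(3) S.x_R[OF Q]] by blast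
  obtain g where g: "g \<in> G k" "w k * c = g * w k \<or> w k * c = g * (xs k * w k)"
    using w_C'[OF P Q c(1)] by blast
  have "a * ys k = \<kappa> * (w k * (h * ys k))" unfolding a(1) by (simp only: mult.assoc)
  also have "\<dots> = \<kappa> * ((w k * c) * h)" unfolding c(2) by (simp only: mult.assoc)
  finally have e: "a * ys k = \<kappa> * ((w k * c) * h)" .
  have "(w k * c) * h \<in> cells k"
    using g(2)
  proof
    assume "w k * c = g * w k"
    then show ?thesis using cells_KwG[OF P Q G_subset_K[OF g(1)] a(3)] by simp
  next
    assume w: "w k * c = g * (xs k * w k)"
    \<comment> \<open>Here the product returns to the first cell: x x cancels and w
      disappears.\<close>
    have "xs k * w k = ys k * xs k" using xs[OF P Q] by (simp add: mult.assoc)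
    then have "(w k * c) * h = (g * ys k) * xs k * h" using w by (simp only: mult.assoc)
    then show ?thesis 
      using cells_G[OF cells_KR[OF K_mult[OF G_subset_K[OF g(1)] y_K[OF Q]] x_R[OF P]] a(3)] by simp
  qed
  then show ?thesis unfolding e using cells_K[OF _ a(2)] by blast
qed

lemma G_cells: "g \<in> G (Suc k) \<Longrightarrow> g \<in> cells k"
proof (induction g rule: span.induct)
  case span_one
  then show ?case using cells_KR[OF one_K span.span_one] by simp
next
  case (span_step g a)
  consider "a \<in> gens x P y Q k" | "a = x (Suc k)" "Suc k \<in> P" | "a = y (Suc k)" "Suc k \<in> Q"
    using span_step(2) by (auto simp: gens_def le_Suc_eq)
  then show ?case
    using cells_G[OF span_step(3) span_base] cells_x[OF span_step(3)] cells_y[OF span_step(3)]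
    by cases auto
qed

end

section \<open>Faithfulness of the action on vectors\<close>

text \<open>Index 0 is excluded since i - 1 would then be i itself, and the maps would not be
  transvections.\<close>

locale A2_action = A2 x P y Q
  for x :: "nat \<Rightarrow> 'g::monoid_mult" and P y Q +
  fixes act :: "'g \<Rightarrow> (nat \<Rightarrow> bit) \<Rightarrow> nat \<Rightarrow> bit"
  assumes act_one: "act 1 v = v"
    and act_mult: "act (g * h) v = act g (act h v)"
    and act_x: "i \<in> P \<Longrightarrow> act (x i) v = v(i := v i + v (i - 1))"
    and act_y: "i \<in> Q \<Longrightarrow> act (y i) v = v(i - 1 := v (i - 1) + v i)"
    and zero_notin: "0 \<notin> P" "0 \<notin> Q"
begin

lemma pos: "{i..j} \<subseteq> P \<or> {i..j} \<subseteq> Q \<Longrightarrow> i \<le> j \<Longrightarrow> 0 < i"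
  using zero_notin by (cases i) auto

lemma act_E: "i \<le> k \<Longrightarrow> {i..k} \<subseteq> P \<Longrightarrow> act (X.E i k) v = v(k := v k + v (i - 1))"
proof (induction k arbitrary: v)
  case 0
  then show ?case by (simp add: act_x)
next
  case (Suc k)
  have P: "Suc k \<in> P" using Suc.prems by auto
  show ?case
  proof (cases "i \<le> k")
    case True
    have sub: "{i..k} \<subseteq> P" using Suc.prems by auto
    have "i - 1 < k"
      using True zero_notin sub by (cases i) auto
    then show ?thesis unfolding X.E_Suc[OF True] act_mult Suc.IH[OF True sub] act_x[OF P]
      by (auto simp: fun_eq_iff add.assoc)
  next
    case False
    then have "i = Suc k" using Suc.prems by simp
    then show ?thesis using P by (simp add: act_x)
  qed
qed

lemma act_F: "i \<le> k \<Longrightarrow> {i..k} \<subseteq> Q \<Longrightarrow> act (Y.E i k) v = v(i - 1 := v (i - 1) + v k)"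
proof (induction k arbitrary: v)
  case 0
  then show ?case by (simp add: act_y)
next
  case (Suc k)
  have P: "Suc k \<in> Q" using Suc.prems by auto
  show ?case
  proof (cases "i \<le> k")
    case True
    have sub: "{i..k} \<subseteq> Q" using Suc.prems by auto
    have "i - 1 < k"
      using True zero_notin sub by (cases i) auto
    then show ?thesis unfolding Y.E_Suc[OF True] act_mult Suc.IH[OF True sub] act_y[OF P]
      by (auto simp: fun_eq_iff add.assoc)
  next
    case False
    then have "i = Suc k" using Suc.prems by simp
    then show ?thesis using P by (simp add: act_y)
  qed
qed

lemma act_G_above: "g \<in> G k \<Longrightarrow> k < j \<Longrightarrow> act g v j = v j"
proof (induction g arbitrary: v rule: span.induct)
  case (span_step g a)
  then show ?case by (auto simp: act_mult gens_def act_x act_y)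
qed (simp add: act_one)

definition unit :: "nat \<Rightarrow> nat \<Rightarrow> bit" where
  "unit j = (\<lambda>i. if i = j then 1 else 0)"

lemma act_G_unit: "g \<in> G k \<Longrightarrow> k < j \<Longrightarrow> act g (unit j) = unit j"
proof (induction g rule: span.induct)
  case (span_step g a)
  have "act a (unit j) = unit j"
    using span_step by (auto simp: gens_def act_x act_y unit_def fun_eq_iff)
  then show ?case using span_step by (simp add: act_mult)
qed (simp add: act_one)

lemma act_inj:
  assumes "g \<in> G k" "act g u = act g v"
  shows "u = v"
proof -
  obtain h where "h * g = 1" using span_inverse[OF assms(1)] gens_invo by blast
  then have "act h (act g v) = v" for v by (simp add: act_one flip: act_mult)
  then show ?thesis using assms(2) by metis
qed

lemma act_C_top: "c \<in> C k \<Longrightarrow> act c v (Suc k) = v (Suc k)"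
proof (induction c arbitrary: v rule: span.induct)
  case (span_step c a)
  then obtain i where i: "a = Y.E i (Suc k)" "i \<le> Suc k" "{i..Suc k} \<subseteq> Q"
    by (auto simp: top_root_def)
  have "i - 1 \<noteq> Suc k" using i zero_notin by auto
  then show ?case using span_step act_F[OF i(2,3)] i(1) by (simp add: act_mult)
qed (simp add: act_one)

text \<open>The factors are split off one at a time. Unit vector i-1 detects
  \<open>E i (Suc k)\<close>: the other elements of the row read different coordinates and fix
  it.\<close>

lemma R_faithful:
  assumes "r \<in> R k" and "\<And>v. act r v (Suc k) = v (Suc k)"
  shows "r = 1"
proof -
  have *: "r = 1"
    if "finite I" "I \<subseteq> {i. i \<le> Suc k \<and> {i..Suc k} \<subseteq> P}"
      "r \<in> span ((\<lambda>i. X.E i (Suc k)) ` I)" "\<And>v. act r v (Suc k) = v (Suc k)" for I r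
    using that
  proof (induction I)
    case empty
    then show ?case by (auto elim: span.cases)
  next
    case (insert i I)
    let ?e = "X.E i (Suc k)"
    have i: "i \<le> Suc k" "{i..Suc k} \<subseteq> P" using insert.prems by auto
    have i0: "0 < i" using pos[of i] i by blast
    have com: "commute ?e a" if "a \<in> (\<lambda>i. X.E i (Suc k)) ` I" for a
      using that X.E_commute[OF i(2,1)] insert.prems(1) by auto
    obtain h where h: "h \<in> span ((\<lambda>i. X.E i (Suc k)) ` I)" "r = h \<or> r = ?e * h"
      using span_insert[of r ?e, OF _ com X.E_invo[OF i]] insert.prems(2) by auto
    have top: "act h (unit (i - 1)) (Suc k) = 0 \<and> (\<forall>j<Suc k. act h (unit (i - 1)) j = unit (i - 1) j)"
      using h(1)
    proof (induction h rule: span.induct)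
      case span_one
      have "i \<noteq> 0" using pos[of i] i by blast
      then show ?case using i by (simp add: act_one unit_def)
    next
      case (span_step h a)
      then obtain j where j: "a = X.E j (Suc k)" "j \<in> I" by auto
      then have j': "j \<le> Suc k" "{j..Suc k} \<subseteq> P" "j \<noteq> i" using insert.prems(1) insert.hyps by auto
      have "i \<noteq> 0" "j \<noteq> 0" using pos[of i] pos[of j] i j' by blast+
      then have "unit (i - 1) (j - 1) = 0" using j' by (auto simp: unit_def)
      then have "act a (unit (i - 1)) = unit (i - 1)"
        unfolding j(1) act_E[OF j'(1,2)] by auto
      then show ?case using span_step by (simp add: act_mult)
    qed
    have ne: "r \<noteq> ?e * h"
    proof
      assume "r = ?e * h"
      then have "act r (unit (i - 1)) (Suc k) = 1"
        using top i i0 by (auto simp: act_mult act_E unit_def)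
      moreover have "unit (i - 1) (Suc k) = 0" using i by (auto simp: unit_def)
      ultimately show False using insert.prems(3) by simp
    qed
    then have "r = h" using h(2) by blast
    then show ?case using insert.IH insert.prems(1,3) h(1) by blast
  qed
  have root: "top_root x P (Suc k) = (\<lambda>i. X.E i (Suc k)) ` {i. i \<le> Suc k \<and> {i..Suc k} \<subseteq> P}"
    unfolding top_root_def by blast
  have fin: "finite {i. i \<le> Suc k \<and> {i..Suc k} \<subseteq> P}"
    by (rule finite_subset[of _ "{..Suc k}"]) auto
  show ?thesis by (rule *[OF fin order_refl assms[unfolded root]])
qed

text \<open>A single test vector is enough for a column: each \<open>Y.E i (Suc k)\<close> adds
  coordinate k+1 to coordinate i-1, and these targets differ for different i.\<close>

lemma C_faithful:
  assumes "c \<in> C k" and "act c (unit (Suc k)) = unit (Suc k)"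
  shows "c = 1"
proof -
  have *: "c = 1"
    if "finite I" "I \<subseteq> {i. i \<le> Suc k \<and> {i..Suc k} \<subseteq> Q}"
      "c \<in> span ((\<lambda>i. Y.E i (Suc k)) ` I)" "act c (unit (Suc k)) = unit (Suc k)" for I c
    using that
  proof (induction I)
    case empty
    then show ?case by (auto elim: span.cases)
  next
    case (insert i I)
    let ?e = "Y.E i (Suc k)"
    have i: "i \<le> Suc k" "{i..Suc k} \<subseteq> Q" using insert.prems by auto
    have i0: "i \<noteq> 0" using pos[of i] i by blast
    have com: "commute ?e a" if "a \<in> (\<lambda>i. Y.E i (Suc k)) ` I" for a
      using that Y.E_commute[OF i(2,1)] insert.prems(1) by auto
    obtain h where h: "h \<in> span ((\<lambda>i. Y.E i (Suc k)) ` I)" "c = h \<or> c = ?e * h"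
      using span_insert[of c ?e, OF _ com Y.E_invo[OF i]] insert.prems(2) by auto
    have top: "act h v (Suc k) = v (Suc k) \<and> act h v (i - 1) = v (i - 1)" for v
      using h(1)
    proof (induction h arbitrary: v rule: span.induct)
      case (span_step h a)
      then obtain j where j: "a = Y.E j (Suc k)" "j \<in> I" by auto
      then have j': "j \<le> Suc k" "{j..Suc k} \<subseteq> Q" "j \<noteq> i" using insert.prems(1) insert.hyps by auto
      have "j \<noteq> 0" using pos[of j] j' by blast
      then have "j - 1 \<noteq> i - 1" "j - 1 \<noteq> Suc k" using j' i0 by linarith+
      then have "act a v (Suc k) = v (Suc k) \<and> act a v (i - 1) = v (i - 1)"
        unfolding j(1) act_F[OF j'(1,2)] by simp
      then show ?case using span_step.IH[of "act a v"] by (simp add: act_mult)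
    qed (simp add: act_one)
    have ne: "c \<noteq> ?e * h"
    proof
      assume "c = ?e * h"
      then have "act c (unit (Suc k)) (i - 1) = unit (Suc k) (i - 1) + unit (Suc k) (Suc k)"
        using top[of "unit (Suc k)"] by (simp add: act_mult act_F[OF i])
      then have "act c (unit (Suc k)) (i - 1) = 1"
        using i i0 by (simp add: unit_def)
      moreover have "unit (Suc k) (i - 1) = 0" using i i0 by (simp add: unit_def)
      ultimately show False using insert.prems(3) by simp
    qed
    then have "c = h" using h(2) by blast
    then show ?case using insert.IH insert.prems(1,3) h(1) by blast
  qed
  have root: "top_root y Q (Suc k) = (\<lambda>i. Y.E i (Suc k)) ` {i. i \<le> Suc k \<and> {i..Suc k} \<subseteq> Q}"
    unfolding top_root_def by blast
  have fin: "finite {i. i \<le> Suc k \<and> {i..Suc k} \<subseteq> Q}"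
    by (rule finite_subset[of _ "{..Suc k}"]) auto
  show ?thesis by (rule *[OF fin order_refl assms[unfolded root]])
qed

text \<open>\<open>K k\<close> preserves coordinate k+1 of every vector, so on the first cell only r
  could change it, whence r = 1. The unit vector k+1 is fixed by \<open>G k\<close> and so forces c
  = 1. On the second cell w moves this unit vector to index k, and coordinate k+1 of its image would
  be 0 instead of 1.\<close>

theorem G_faithful: "g \<in> G k \<Longrightarrow> (\<And>v. act g v = v) \<Longrightarrow> g = 1"
proof (induction k arbitrary: g)
  case 0
  have "gens x P y Q 0 = {}" using zero_notin by (auto simp: gens_def)
  then show ?case using 0 by (auto elim: span.cases)
next
  case (Suc k)
  have K_top: "act \<kappa> v (Suc k) = v (Suc k)" if "\<kappa> \<in> K k" for \<kappa> v
    using that unfolding K_def by (auto simp: act_mult act_G_above act_C_top)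
  from G_cells[OF Suc.prems(1)] show ?case
  proof (cases rule: cellsE)
    case (1 \<kappa> r)
    have "act r v (Suc k) = v (Suc k)" for v
    proof -
      have "act \<kappa> (act r v) = v" using Suc.prems(2)[of v] 1 by (simp add: act_mult)
      then show ?thesis using K_top[OF 1(2), of "act r v"] by simp
    qed
    then have r: "r = 1" using R_faithful[OF 1(3)] by blast
    obtain h c where h: "\<kappa> = h * c" "h \<in> G k" "c \<in> C k" using 1(2) unfolding K_def by blast
    have "act h (act c v) = v" for v using Suc.prems(2)[of v] 1 r h by (simp add: act_mult)
    then have "act h (act c (unit (Suc k))) = act h (unit (Suc k))"
      using act_G_unit[OF h(2)] by simp
    then have c: "c = 1" by (rule C_faithful[OF h(3) act_inj[OF h(2)]])
    have g: "g = h" using 1 r h c by simp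
    then show ?thesis using Suc.IH[OF h(2)] Suc.prems(2) by blast
  next
    case (2 \<kappa> h)
    let ?u = "unit (Suc k)"
    have "act \<kappa> (act (w k) (act h ?u)) = ?u"
      using Suc.prems(2)[of ?u] 2 by (simp only: act_mult)
    then have "act (w k) ?u (Suc k) = 1"
      using K_top[OF 2(2), of "act (w k) ?u"] act_G_unit[OF 2(3)] by (simp add: unit_def)
    moreover have "act (w k) ?u (Suc k) = 0"
      using act_x[OF 2(4)] act_y[OF 2(5)] by (simp add: act_mult unit_def)
    ultimately show ?thesis by simp
  qed
qed

end

section \<open>Presented groups and transvections\<close>

lemma pres_eq_subset: "(u, v) \<in> pres_eq S R \<Longrightarrow> set u \<subseteq> S \<and> set v \<subseteq> S"
  by (induction rule: pres_eq.induct) auto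

lemma pres_eq_cong:
  "(u, v) \<in> pres_eq S R \<Longrightarrow> set p \<subseteq> S \<Longrightarrow> set q \<subseteq> S \<Longrightarrow> (p @ u @ q, p @ v @ q) \<in> pres_eq S R"
proof (induction rule: pres_eq.induct)
  case (refl w)
  then show ?case by (intro pres_eq.refl) simp
next
  case (rel u v r)
  then show ?case using pres_eq.rel[of "p @ u" S "v @ q" r R] by simp
qed (blast intro: pres_eq.intros)+

lemma equiv_pres_eq: "equiv (lists S) (pres_eq S R)"
  by (rule equivI)
    (auto simp: refl_on_def sym_def trans_def lists_eq_set dest: pres_eq_subset intro: pres_eq.intros)

lemma pres_eq_rev:
  assumes "\<And>a. a \<in> S \<Longrightarrow> [a, a] \<in> R" and "set w \<subseteq> S"
  shows "(w @ rev w, []) \<in> pres_eq S R"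
  using assms(2)
proof (induction w)
  case Nil
  then show ?case by (simp add: pres_eq.refl)
next
  case (Cons a w)
  then have "([a] @ (w @ rev w) @ [a], [a] @ [] @ [a]) \<in> pres_eq S R"
    by (intro pres_eq_cong) auto
  moreover have "([] @ [a, a] @ [], [] @ []) \<in> pres_eq S R"
    using Cons.prems by (intro pres_eq.rel assms(1)) auto
  ultimately show ?case by (auto intro: pres_eq.trans)
qed

text \<open>The isomorphism goes from H to the presented group and sends an element to its fibre
  under \<open>\<phi>\<close>, which by \<open>eq\<close> is one congruence class.\<close>

lemma presented_group_iso:
  assumes eq: "\<And>u v. set u \<subseteq> S \<Longrightarrow> set v \<subseteq> S \<Longrightarrow> (u, v) \<in> pres_eq S R \<longleftrightarrow> \<phi> u = \<phi> v"
    and onto: "carrier H = \<phi> ` lists S"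
    and hom: "\<And>u v. set u \<subseteq> S \<Longrightarrow> set v \<subseteq> S \<Longrightarrow> \<phi> (u @ v) = \<phi> u \<otimes>\<^bsub>H\<^esub> \<phi> v"
  shows "H \<cong> presented_group S R"
proof -
  let ?\<psi> = "\<lambda>A. {w \<in> lists S. \<phi> w = A}"
  have cls: "?\<psi> (\<phi> u) = pres_eq S R `` {u}" if "set u \<subseteq> S" for u
    using eq[OF that] pres_eq_subset by fastforce
  have "?\<psi> \<in> hom H (presented_group S R)"
  proof (rule homI)
    fix A assume "A \<in> carrier H"
    then obtain u where "set u \<subseteq> S" "A = \<phi> u" unfolding onto by auto
    then show "?\<psi> A \<in> carrier (presented_group S R)"
      unfolding presented_group_def using cls by (auto intro: quotientI)
  next
    fix A B assume "A \<in> carrier H" "B \<in> carrier H"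
    then obtain u v where uv: "set u \<subseteq> S" "A = \<phi> u" "set v \<subseteq> S" "B = \<phi> v"
      unfolding onto by auto
    \<comment> \<open>Multiplication of classes is defined through chosen representatives; all that
      is known of them is their image under \<open>\<phi>\<close>, and that is enough.\<close>
    let ?a = "SOME a. a \<in> ?\<psi> A" and ?b = "SOME b. b \<in> ?\<psi> B"
    have "?a \<in> ?\<psi> A" "?b \<in> ?\<psi> B" using uv by (intro someI_ex[of "\<lambda>a. a \<in> ?\<psi> _"]; auto)+
    then have "set ?a \<subseteq> S" "\<phi> ?a = A" "set ?b \<subseteq> S" "\<phi> ?b = B" by auto
    then show "?\<psi> (A \<otimes>\<^bsub>H\<^esub> B) = ?\<psi> A \<otimes>\<^bsub>presented_group S R\<^esub> ?\<psi> B"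
      using cls[of "?a @ ?b"] hom[of ?a ?b] unfolding presented_group_def by simp
  qed
  moreover have "bij_betw ?\<psi> (carrier H) (carrier (presented_group S R))"
  proof (rule bij_betw_imageI)
    show "inj_on ?\<psi> (carrier H)" by (rule inj_onI) (auto simp: onto)
    show "?\<psi> ` carrier H = carrier (presented_group S R)"
      unfolding onto presented_group_def using cls
      by (auto simp: quotient_def image_iff)
  qed
  ultimately show ?thesis unfolding is_iso_def iso_def by blast
qed

text \<open>A monoid type in which each generator acts both on the classes of the presented group
  (faithfully, by left multiplication) and on vectors. Since its elements are total functions,
  left multiplication is extended by the identity outside the quotient, so that relators act as 1.\<close>
datatype ('a, 'b) endo = Endo (lact: "'a \<Rightarrow> 'a") (ract: "'b \<Rightarrow> 'b")

instantiation endo :: (type, type) monoid_mult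
begin
definition "1 = Endo id id"
definition "f * g = Endo (lact f \<circ> lact g) (ract f \<circ> ract g)"
instance by standard (simp_all add: one_endo_def times_endo_def comp_assoc)
end

fun transv :: "gen \<Rightarrow> (nat \<Rightarrow> bit) \<Rightarrow> nat \<Rightarrow> bit" where
  "transv (Xg i) v = v(i := v i + v (i - 1))"
| "transv (Yg i) v = v(i - 1 := v (i - 1) + v i)"

definition left_mult :: "('a list \<times> 'a list) set \<Rightarrow> 'a set \<Rightarrow> 'a \<Rightarrow> 'a list set \<Rightarrow> 'a list set" where
  "left_mult r S a C = (if C \<in> lists S // r then r `` {a # (SOME w. w \<in> C)} else C)"

lemma left_mult_class:
  assumes "a \<in> S" "set w \<subseteq> S"
  shows "left_mult (pres_eq S R) S a (pres_eq S R `` {w}) = pres_eq S R `` {a # w}"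
proof -
  let ?w = "SOME u. u \<in> pres_eq S R `` {w}"
  have "w \<in> pres_eq S R `` {w}" using assms(2) by (auto intro: pres_eq.refl)
  then have "?w \<in> pres_eq S R `` {w}" by (rule someI)
  then have "(w, ?w) \<in> pres_eq S R" by simp
  then have "([a] @ w @ [], [a] @ ?w @ []) \<in> pres_eq S R" using assms by (intro pres_eq_cong) auto
  then have "pres_eq S R `` {a # ?w} = pres_eq S R `` {a # w}"
    using equiv_class_eq[OF equiv_pres_eq[of S R]] by fastforce
  moreover have "pres_eq S R `` {w} \<in> lists S // pres_eq S R" using assms by (auto intro: quotientI)
  ultimately show ?thesis by (simp add: left_mult_def)
qed

definition word_val :: "('a \<Rightarrow> 'g::monoid_mult) \<Rightarrow> 'a list \<Rightarrow> 'g" where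
  "word_val f w = prod_list (map f w)"

lemma word_val_simps [simp]:
  "word_val f [] = 1" "word_val f (a # w) = f a * word_val f w"
  "word_val f (u @ v) = word_val f u * word_val f v"
  by (simp_all add: word_val_def)

lemma word_val_pow: "word_val f (word_pow w m) = word_val f w ^ m"
  unfolding word_pow_def by (induction m) simp_all

lemma ract_word_val: "ract (word_val (\<lambda>a. Endo (f a) (g a)) w) v = foldr g w v"
  by (induction w) (simp_all add: one_endo_def times_endo_def)

lemma lact_word_val_class:
  assumes "set w \<subseteq> S" "set u \<subseteq> S"
  shows "lact (word_val (\<lambda>a. Endo (left_mult (pres_eq S R) S a) (g a)) w) (pres_eq S R `` {u}) = pres_eq S R `` {w @ u}"
  using assms
  by (induction w) (simp_all add: one_endo_def times_endo_def left_mult_class)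

lemma lact_word_val_outside:
  assumes "C \<notin> lists S // pres_eq S R"
  shows "lact (word_val (\<lambda>a. Endo (left_mult (pres_eq S R) S a) (g a)) w) C = C"
  using assms by (induction w) (simp_all add: one_endo_def times_endo_def left_mult_def)

text \<open>The trivial left component places a transvection in the monoid \<open>endo\<close>, so
  that the lemmas on involutions and powers apply to it before anything is known about the presented
  group.\<close>

definition transv_endo :: "gen \<Rightarrow> (unit, nat \<Rightarrow> bit) endo" where
  "transv_endo a = Endo id (transv a)"

section \<open>The transvections satisfy the relations\<close>

lemma bit_double [simp]: "(b::bit) + b = 0" "b + (b + c) = c"
  by (cases b; cases c; simp)+

lemma transv_endo_invo: "a \<in> A2_X n \<Longrightarrow> invo (transv_endo a)"
  by (cases a) (auto simp: A2_X_def invo_def transv_endo_def one_endo_def times_endo_def fun_eq_iff)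


text \<open>The long relators involve at most three consecutive indices and hence four consecutive
  coordinates. Naming these four entries reduces each such relation to symbolic addition of
  bits.\<close>

definition vec4 :: "nat \<Rightarrow> (nat \<Rightarrow> bit) \<Rightarrow> bit \<Rightarrow> bit \<Rightarrow> bit \<Rightarrow> bit \<Rightarrow> nat \<Rightarrow> bit" where
  "vec4 i v p q r s = v(i := p, Suc i := q, Suc (Suc i) := r, Suc (Suc (Suc i)) := s)"

lemma transv_vec4:
  "transv (Xg (Suc i)) (vec4 i v p q r s) = vec4 i v p (q + p) r s"
  "transv (Xg (Suc (Suc i))) (vec4 i v p q r s) = vec4 i v p q (r + q) s"
  "transv (Xg (Suc (Suc (Suc i)))) (vec4 i v p q r s) = vec4 i v p q r (s + r)"
  "transv (Yg (Suc i)) (vec4 i v p q r s) = vec4 i v (p + q) q r s"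
  "transv (Yg (Suc (Suc i))) (vec4 i v p q r s) = vec4 i v p (q + r) r s"
  "transv (Yg (Suc (Suc (Suc i)))) (vec4 i v p q r s) = vec4 i v p q (r + s) s"
  by (auto simp: vec4_def fun_eq_iff)

lemma endo_eq_one_vec4:
  assumes "\<And>v p q r s. ract f (vec4 i v p q r s) = vec4 i v p q r s" and "lact f = id"
  shows "f = 1"
proof -
  have "ract f v = v" for v
    using assms(1)[of v "v i" "v (Suc i)" "v (Suc (Suc i))" "v (Suc (Suc (Suc i)))"]
    by (simp add: vec4_def)
  then show ?thesis using assms(2) by (cases f) (auto simp: one_endo_def)
qed

lemma transv_endo_pow:
  "(transv_endo (Xg (Suc i)) * transv_endo (Xg (Suc (Suc i)))) ^ 4 = 1"
  "(transv_endo (Yg (Suc i)) * transv_endo (Yg (Suc (Suc i)))) ^ 4 = 1"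
  "(transv_endo (Xg (Suc i)) * transv_endo (Yg (Suc i))) ^ 3 = 1"
  "(transv_endo (Xg (Suc i)) * transv_endo (Xg (Suc (Suc i))) * transv_endo (Yg (Suc i))) ^ 3 = 1"
  "(transv_endo (Xg (Suc i)) * transv_endo (Xg (Suc (Suc i))) * transv_endo (Yg (Suc (Suc i)))) ^ 3 = 1"
  "(transv_endo (Xg (Suc i)) * transv_endo (Yg (Suc i)) * transv_endo (Yg (Suc (Suc i)))) ^ 3 = 1"
  "(transv_endo (Xg (Suc (Suc i))) * transv_endo (Yg (Suc i)) * transv_endo (Yg (Suc (Suc i)))) ^ 3 = 1"
  "(transv_endo (Xg (Suc i)) * transv_endo (Xg (Suc (Suc i))) * transv_endo (Xg (Suc (Suc (Suc i))))) ^ 4 = 1"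
  "(transv_endo (Yg (Suc i)) * transv_endo (Yg (Suc (Suc i))) * transv_endo (Yg (Suc (Suc (Suc i))))) ^ 4 = 1"
  by (rule endo_eq_one_vec4[where i = i];
      simp only: pow3 pow4 transv_endo_def times_endo_def transv_vec4 endo.sel comp_apply id_comp
        add.assoc add.left_commute add.commute bit_double add_0_left add_0_right)+

lemma transv_endo_commute:
  shows "Suc i < j \<Longrightarrow> 0 < i \<Longrightarrow> commute (transv_endo (Xg i)) (transv_endo (Xg j))"
    and "Suc i < j \<Longrightarrow> 0 < i \<Longrightarrow> commute (transv_endo (Yg i)) (transv_endo (Yg j))"
    and "i \<noteq> j \<Longrightarrow> 0 < i \<Longrightarrow> 0 < j \<Longrightarrow> commute (transv_endo (Xg i)) (transv_endo (Yg j))"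
proof -
  have c: "commute (transv_endo a) (transv_endo b)" if "\<And>v. transv a (transv b v) = transv b (transv a v)" for a b
    using that by (simp add: commute_def transv_endo_def times_endo_def comp_def)
  show "commute (transv_endo (Xg i)) (transv_endo (Xg j))" if ij: "Suc i < j" "0 < i"
  proof -
    have "j - 1 \<noteq> i" "i - 1 \<noteq> j" "i \<noteq> j" using ij by auto
    then show ?thesis by (intro c) (simp add: fun_upd_twist)
  qed
  show "commute (transv_endo (Yg i)) (transv_endo (Yg j))" if ij: "Suc i < j" "0 < i"
  proof -
    have "j - 1 \<noteq> i" "i - 1 \<noteq> j" "i - 1 \<noteq> j - 1" using ij by auto
    then show ?thesis by (intro c) (simp add: fun_upd_twist)
  qed
  show "commute (transv_endo (Xg i)) (transv_endo (Yg j))" if ij: "i \<noteq> j" "0 < i" "0 < j"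
  proof -
    have "j - 1 \<noteq> i - 1" "i - 1 \<noteq> i" "j - 1 \<noteq> j" using ij by auto
    note ne = this
    show ?thesis
    proof (cases "i = j - 1")
      case True
      \<comment> \<open>x_i and y_(i+1) both add to coordinate i, so here the two updates do not
        have disjoint targets and commutativity of addition is used.\<close>
      have "v i + v j + v (i - 1) = v i + v (i - 1) + v j" for v :: "nat \<Rightarrow> bit"
        by (simp only: add.assoc add.left_commute add.commute)
      then show ?thesis using ne ij(1) True by (intro c) simp
    next
      case False
      then show ?thesis using ne ij(1) by (intro c) (simp add: fun_upd_twist[of i "j - Suc 0"])
    qed
  qed
qed

lemma invo_pow2: "invo a \<Longrightarrow> invo b \<Longrightarrow> commute a b \<Longrightarrow> (a * b) ^ 2 = 1"
  using invo_mult[of a b] by (simp add: invo_def power2_eq_square)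

lemma pow2_commute: 
  assumes "invo a" "invo b" "(a * b) ^ 2 = 1"
  shows "commute a b"
proof -
  have "b * a = a * ((a * b) ^ 2) * b"
    using assms(2) invo_left[OF assms(1)] by (simp add: power2_eq_square mult.assoc invo_def)
  then show ?thesis using assms(3) by (simp add: commute_def)
qed

text \<open>The relators run over all orderings of a triple while g depends only on the set. The
  three rotations and their reversals are all six orderings.\<close>

lemma pow_perm3:
  assumes "distinct [a, b, c]" "{a, b, c} = {a', b', c'}"
    and inv: "invo (f a')" "invo (f b')" "invo (f c')" and pow: "(f a' * f b' * f c') ^ m = 1"
  shows "(f a * f b * f c) ^ m = 1"
proof -
  have 1: "(f b' * f c' * f a') ^ m = 1"
    using pow_rot[OF inv(1), of "f b' * f c'" m] pow by (simp add: mult.assoc)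
  have 2: "(f c' * f a' * f b') ^ m = 1"
    using pow_rot[OF inv(2), of "f c' * f a'" m] 1 by (simp add: mult.assoc)
  have "(a, b, c) \<in> {(a', b', c'), (b', c', a'), (c', a', b'), (c', b', a'), (a', c', b'), (b', a', c')}"
  proof -
    have "a \<in> {a', b', c'}" "b \<in> {a', b', c'}" "c \<in> {a', b', c'}" using assms(2) by blast+
    then show ?thesis using assms(1) by auto
  qed
  then show ?thesis
    using pow 1 2 pow_rev[OF inv pow] pow_rev[OF inv(2,3,1) 1] pow_rev[OF inv(3,1,2) 2]
    by (elim insertE; simp)
qed

lemma A2_f_values:
  "1 \<le> i \<Longrightarrow> Suc i \<le> n \<Longrightarrow> A2_f n (Xg i) (Xg (Suc i)) = 4"
  "1 \<le> i \<Longrightarrow> Suc i \<le> n \<Longrightarrow> A2_f n (Yg i) (Yg (Suc i)) = 4"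
  "1 \<le> i \<Longrightarrow> i \<le> n \<Longrightarrow> A2_f n (Xg i) (Yg i) = 3"
  "Suc i < j \<Longrightarrow> A2_f n (Xg i) (Xg j) = 2"
  "Suc i < j \<Longrightarrow> A2_f n (Yg i) (Yg j) = 2"
  "i \<noteq> j \<Longrightarrow> A2_f n (Xg i) (Yg j) = 2"
  by (auto simp: A2_f_def doubleton_eq_iff)

lemma A2_g_values:
  assumes "1 \<le> i"
  shows "Suc i \<le> n \<Longrightarrow> A2_g n (Xg i) (Xg (Suc i)) (Yg i) = 3"
    "Suc i \<le> n \<Longrightarrow> A2_g n (Xg i) (Xg (Suc i)) (Yg (Suc i)) = 3"
    "Suc i \<le> n \<Longrightarrow> A2_g n (Yg i) (Yg (Suc i)) (Xg i) = 3"
    "Suc i \<le> n \<Longrightarrow> A2_g n (Yg i) (Yg (Suc i)) (Xg (Suc i)) = 3"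
    "Suc (Suc i) \<le> n \<Longrightarrow> A2_g n (Xg i) (Xg (Suc i)) (Xg (Suc (Suc i))) = 4"
    "Suc (Suc i) \<le> n \<Longrightarrow> A2_g n (Yg i) (Yg (Suc i)) (Yg (Suc (Suc i))) = 4"
proof -
  have 3: "A2_g n a b c = 3" if "Suc i \<le> n" "{a, b, c} = {Xg i, Xg (Suc i), Yg i} \<or> {a, b, c} = {Xg i, Xg (Suc i), Yg (Suc i)}
         \<or> {a, b, c} = {Xg i, Yg i, Yg (Suc i)} \<or> {a, b, c} = {Xg (Suc i), Yg i, Yg (Suc i)}" for a b c
  proof -
    have "i < n" using that(1) by simp
    then show ?thesis unfolding A2_g_def using that(2) assms by (intro if_P exI[of _ i] conjI)
  qed
  show "Suc i \<le> n \<Longrightarrow> A2_g n (Xg i) (Xg (Suc i)) (Yg i) = 3"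
    "Suc i \<le> n \<Longrightarrow> A2_g n (Xg i) (Xg (Suc i)) (Yg (Suc i)) = 3"
    "Suc i \<le> n \<Longrightarrow> A2_g n (Yg i) (Yg (Suc i)) (Xg i) = 3"
    "Suc i \<le> n \<Longrightarrow> A2_g n (Yg i) (Yg (Suc i)) (Xg (Suc i)) = 3"
    by (rule 3; auto)+
  have 4: "A2_g n a b c = 4" if "Suc (Suc i) \<le> n"
    "{a, b, c} = {Xg i, Xg (i + 1), Xg (i + 2)} \<or> {a, b, c} = {Yg i, Yg (i + 1), Yg (i + 2)}" for a b c
  proof -
    \<comment> \<open>The triples with value 3 contain generators of both kinds, so a triple of one
      kind cannot fall into the first branch of \<open>A2_g\<close>.\<close>
    have no: "\<not> (\<exists>j. Xg j \<in> {a, b, c}) \<or> \<not> (\<exists>j. Yg j \<in> {a, b, c})"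
      using that(2)
    proof
      assume e: "{a, b, c} = {Xg i, Xg (i + 1), Xg (i + 2)}"
      show ?thesis unfolding e by simp
    next
      assume e: "{a, b, c} = {Yg i, Yg (i + 1), Yg (i + 2)}"
      show ?thesis unfolding e by simp
    qed
    have "\<not> (\<exists>i. 1 \<le> i \<and> i < n \<and>
          ({a, b, c} = {Xg i, Xg (Suc i), Yg i} \<or> {a, b, c} = {Xg i, Xg (Suc i), Yg (Suc i)}
         \<or> {a, b, c} = {Xg i, Yg i, Yg (Suc i)} \<or> {a, b, c} = {Xg (Suc i), Yg i, Yg (Suc i)}))"
      (is "\<not> ?A")
    proof
      assume ?A
      then have "(\<exists>j. Xg j \<in> {a, b, c}) \<and> (\<exists>j. Yg j \<in> {a, b, c})"
        by (elim exE conjE disjE) (simp only: insert_iff; blast)+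
      then show False using no by blast
    qed
    moreover have "i + 2 \<le> n" using that(1) by simp
    then have "\<exists>i. 1 \<le> i \<and> i + 2 \<le> n \<and>
          ({a, b, c} = {Xg i, Xg (i+1), Xg (i+2)} \<or> {a, b, c} = {Yg i, Yg (i+1), Yg (i+2)})"
      using that(2) assms by blast
    ultimately show ?thesis unfolding A2_g_def by (simp only: if_False if_True)
  qed
  show "Suc (Suc i) \<le> n \<Longrightarrow> A2_g n (Xg i) (Xg (Suc i)) (Xg (Suc (Suc i))) = 4"
    "Suc (Suc i) \<le> n \<Longrightarrow> A2_g n (Yg i) (Yg (Suc i)) (Yg (Suc (Suc i))) = 4"
    by (rule 4; simp)+
qed

lemma transv_endo_f_relator:
  assumes "a \<in> A2_X n" "b \<in> A2_X n" "a \<noteq> b"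
  shows "(transv_endo a * transv_endo b) ^ A2_f n a b = 1"
proof -
  have flip: "(transv_endo b * transv_endo a) ^ A2_f n b a = 1" if "(transv_endo a * transv_endo b) ^ A2_f n a b = 1" "a \<in> A2_X n" for a b
  proof -
    have "A2_f n b a = A2_f n a b" by (simp only: A2_f_def insert_commute[of b a])
    then show ?thesis using pow_rot[OF transv_endo_invo[OF that(2)] that(1)] by simp
  qed
  have X: "(transv_endo (Xg i) * transv_endo (Xg j)) ^ A2_f n (Xg i) (Xg j) = 1"
    if "i < j" "Xg i \<in> A2_X n" "Xg j \<in> A2_X n" for i j
  proof (cases "j = Suc i")
    case True
    then show ?thesis using that transv_endo_pow(1)[of "i - 1"] by (simp add: A2_f_values A2_X_def)
  next
    case False
    then show ?thesis using that transv_endo_commute(1)[of i j] transv_endo_invo[OF that(2)] transv_endo_invo[OF that(3)]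
      by (simp add: A2_f_values A2_X_def invo_pow2)
  qed
  have Y: "(transv_endo (Yg i) * transv_endo (Yg j)) ^ A2_f n (Yg i) (Yg j) = 1"
    if "i < j" "Yg i \<in> A2_X n" "Yg j \<in> A2_X n" for i j
  proof (cases "j = Suc i")
    case True
    then show ?thesis using that transv_endo_pow(2)[of "i - 1"] by (simp add: A2_f_values A2_X_def)
  next
    case False
    then show ?thesis using that transv_endo_commute(2)[of i j] transv_endo_invo[OF that(2)] transv_endo_invo[OF that(3)]
      by (simp add: A2_f_values A2_X_def invo_pow2)
  qed
  have XY: "(transv_endo (Xg i) * transv_endo (Yg j)) ^ A2_f n (Xg i) (Yg j) = 1"
    if "Xg i \<in> A2_X n" "Yg j \<in> A2_X n" for i j
  proof (cases "i = j")
    case True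
    then show ?thesis using that transv_endo_pow(3)[of "i - 1"] by (simp add: A2_f_values A2_X_def)
  next
    case False
    then show ?thesis using that transv_endo_commute(3)[of i j] transv_endo_invo[OF that(1)] transv_endo_invo[OF that(2)]
      by (simp add: A2_f_values A2_X_def invo_pow2)
  qed
  show ?thesis
  proof (cases a; cases b)
    fix i j assume ab: "a = Xg i" "b = Xg j"
    then show ?thesis using X[of i j] flip[OF X, of j i] assms by (cases "i < j") auto
  next
    fix i j assume ab: "a = Yg i" "b = Yg j"
    then show ?thesis using Y[of i j] flip[OF Y, of j i] assms by (cases "i < j") auto
  next
    fix i j assume ab: "a = Xg i" "b = Yg j"
    then show ?thesis using XY assms by auto
  next
    fix i j assume ab: "a = Yg i" "b = Xg j"
    then show ?thesis using flip[OF XY, of j i] assms by auto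
  qed
qed

lemma transv_endo_g_relator:
  assumes X: "a \<in> A2_X n" "b \<in> A2_X n" "c \<in> A2_X n" and d: "distinct [a, b, c]"
  shows "(transv_endo a * transv_endo b * transv_endo c) ^ A2_g n a b c = 1"
proof -
  have *: "(transv_endo a * transv_endo b * transv_endo c) ^ m = 1"
    if "{a, b, c} = {a', b', c'}" "(transv_endo a' * transv_endo b' * transv_endo c') ^ m = 1" for a' b' c' m
  proof -
    have "{a', b', c'} \<subseteq> A2_X n" unfolding that(1)[symmetric] using X by blast
    then have "a' \<in> A2_X n" "b' \<in> A2_X n" "c' \<in> A2_X n" by blast+
    then show ?thesis by (intro pow_perm3[OF d that(1) _ _ _ that(2)] transv_endo_invo)
  qed
  let ?A = "\<exists>i. 1 \<le> i \<and> i < n \<and>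
          ({a, b, c} = {Xg i, Xg (Suc i), Yg i} \<or> {a, b, c} = {Xg i, Xg (Suc i), Yg (Suc i)}
         \<or> {a, b, c} = {Xg i, Yg i, Yg (Suc i)} \<or> {a, b, c} = {Xg (Suc i), Yg i, Yg (Suc i)})"
  let ?B = "\<exists>i. 1 \<le> i \<and> i + 2 \<le> n \<and>
          ({a, b, c} = {Xg i, Xg (i+1), Xg (i+2)} \<or> {a, b, c} = {Yg i, Yg (i+1), Yg (i+2)})"
  consider ?A | "\<not> ?A" ?B | "\<not> ?A" "\<not> ?B" by blast
  then show ?thesis
  proof cases
    case 1
    then obtain i where i: "1 \<le> i"
      "{a, b, c} = {Xg i, Xg (Suc i), Yg i} \<or> {a, b, c} = {Xg i, Xg (Suc i), Yg (Suc i)}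
         \<or> {a, b, c} = {Xg i, Yg i, Yg (Suc i)} \<or> {a, b, c} = {Xg (Suc i), Yg i, Yg (Suc i)}" by blast
    have "A2_g n a b c = 3" unfolding A2_g_def using 1 by (rule if_P)
    moreover have "(transv_endo a * transv_endo b * transv_endo c) ^ 3 = 1"
      using i(2) *[OF _ transv_endo_pow(4)[of "i - 1"]] *[OF _ transv_endo_pow(5)[of "i - 1"]]
        *[OF _ transv_endo_pow(6)[of "i - 1"]] *[OF _ transv_endo_pow(7)[of "i - 1"]] i(1) by (elim disjE) simp_all
    ultimately show ?thesis by simp
  next
    case 2
    then obtain i where i: "1 \<le> i"
      "{a, b, c} = {Xg i, Xg (i+1), Xg (i+2)} \<or> {a, b, c} = {Yg i, Yg (i+1), Yg (i+2)}" by blast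
    have "A2_g n a b c = 4" unfolding A2_g_def using 2 by simp
    moreover have "(transv_endo a * transv_endo b * transv_endo c) ^ 4 = 1"
      using i(2) *[OF _ transv_endo_pow(8)[of "i - 1"]] *[OF _ transv_endo_pow(9)[of "i - 1"]] i(1) by (elim disjE) simp_all
    ultimately show ?thesis by simp
  next
    case 3
    have "A2_g n a b c = 0" unfolding A2_g_def using 3 by simp
    then show ?thesis by simp
  qed
qed

lemma transv_endo_relator:
  assumes r: "r \<in> coxeter2_relators S (A2_f n) (A2_g n)" and S: "S \<subseteq> A2_X n"
  shows "word_val transv_endo r = 1"
proof -
  from r consider a where "a \<in> S" "r = [a, a]"
    | a b where "a \<in> S" "b \<in> S" "a \<noteq> b" "r = word_pow [a, b] (A2_f n a b)"
    | a b c where "a \<in> S" "b \<in> S" "c \<in> S" "distinct [a, b, c]" "r = word_pow [a, b, c] (A2_g n a b c)"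
    unfolding coxeter2_relators_def by blast
  then show ?thesis
  proof cases
    case 1
    then show ?thesis using transv_endo_invo S by (auto simp: invo_def)
  next
    case 2
    then show ?thesis using transv_endo_f_relator[of a n b] S by (auto simp: word_val_pow)
  next
    case 3
    then show ?thesis using transv_endo_g_relator[of a n b c] S by (auto simp: word_val_pow mult.assoc)
  qed
qed

lemma foldr_transv_relator:
  assumes "r \<in> coxeter2_relators S (A2_f n) (A2_g n)" and "S \<subseteq> A2_X n"
  shows "foldr transv r v = v"
proof -
  have "(\<lambda>a. Endo id (transv a)) = transv_endo" by (simp add: transv_endo_def fun_eq_iff)
  then have "ract (word_val transv_endo r) v = foldr transv r v"
    using ract_word_val[of "\<lambda>_. id :: unit \<Rightarrow> unit" transv r v] by (simp only:)
  then show ?thesis by (simp add: transv_endo_relator[OF assms] one_endo_def)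
qed

section \<open>The kernel of the word map\<close>

locale A2_system =
  fixes n :: nat and S :: "gen set"
  assumes S_subset: "S \<subseteq> A2_X n"
begin

definition rels where "rels = coxeter2_relators S (A2_f n) (A2_g n)"

definition val :: "gen \<Rightarrow> (gen list set, nat \<Rightarrow> bit) endo" where
  "val a = Endo (left_mult (pres_eq S rels) S a) (transv a)"

lemma val_abs: "val = (\<lambda>a. Endo (left_mult (pres_eq S rels) S a) (transv a))"
  by (simp add: val_def fun_eq_iff)

lemma ract_val: "ract (word_val val w) v = foldr transv w v"
  unfolding val_abs by (rule ract_word_val)

lemma lact_val: "set w \<subseteq> S \<Longrightarrow> set u \<subseteq> S \<Longrightarrow>
  lact (word_val val w) (pres_eq S rels `` {u}) = pres_eq S rels `` {w @ u}"
  unfolding val_abs by (rule lact_word_val_class)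

lemma val_relator:
  assumes r: "r \<in> rels" "set r \<subseteq> S"
  shows "word_val val r = 1"
proof -
  have "lact (word_val val r) C = C" for C
  proof (cases "C \<in> lists S // pres_eq S rels")
    case True
    then obtain u where u: "set u \<subseteq> S" "C = pres_eq S rels `` {u}" by (auto simp: quotient_def)
    have "([] @ r @ u, [] @ u) \<in> pres_eq S rels" using r u by (intro pres_eq.rel) auto
    then have "pres_eq S rels `` {r @ u} = pres_eq S rels `` {u}"
      using equiv_class_eq[OF equiv_pres_eq] by fastforce
    then show ?thesis using lact_val[OF r(2) u(1)] u(2) by simp
  next
    case False
    then show ?thesis unfolding val_abs by (rule lact_word_val_outside)
  qed
  moreover have "ract (word_val val r) v = v" for v
    using foldr_transv_relator[OF r(1)[unfolded rels_def] S_subset] by (simp add: ract_val)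
  ultimately show ?thesis by (intro endo.expand) (auto simp: one_endo_def)
qed

lemma val_invo: "a \<in> S \<Longrightarrow> invo (val a)"
  using val_relator[of "[a, a]"] by (simp add: invo_def rels_def coxeter2_relators_def)

lemma val_pow2:
  assumes "a \<in> S" "b \<in> S" "a \<noteq> b"
  shows "(val a * val b) ^ A2_f n a b = 1"
proof -
  have "word_pow [a, b] (A2_f n a b) \<in> rels"
    unfolding rels_def coxeter2_relators_def using assms by blast
  moreover have "set (word_pow [a, b] m) \<subseteq> S" for m
    using assms by (auto simp: word_pow_def)
  ultimately show ?thesis using val_relator by (fastforce simp: word_val_pow)
qed

lemma val_pow3:
  assumes "a \<in> S" "b \<in> S" "c \<in> S" "distinct [a, b, c]"
  shows "(val a * val b * val c) ^ A2_g n a b c = 1"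
proof -
  have "word_pow [a, b, c] (A2_g n a b c) \<in> rels"
    unfolding rels_def coxeter2_relators_def using assms by blast
  moreover have "set (word_pow [a, b, c] m) \<subseteq> S" for m
    using assms by (auto simp: word_pow_def)
  ultimately show ?thesis using val_relator by (fastforce simp: word_val_pow mult.assoc)
qed

lemma val_commute: "a \<in> S \<Longrightarrow> b \<in> S \<Longrightarrow> a \<noteq> b \<Longrightarrow> A2_f n a b = 2 \<Longrightarrow> commute (val a) (val b)"
  using val_pow2[of a b] by (auto intro: pow2_commute val_invo)

lemma S_bounds: "Xg i \<in> S \<Longrightarrow> 1 \<le> i \<and> i \<le> n" "Yg i \<in> S \<Longrightarrow> 1 \<le> i \<and> i \<le> n"
  using S_subset by (auto simp: A2_X_def)

lemma pair_X: "unipotent_pair (val \<circ> Xg) {i. Xg i \<in> S} (val \<circ> Yg) {i. Yg i \<in> S}"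
proof (unfold_locales; unfold mem_Collect_eq comp_apply)
  fix i assume i: "Xg i \<in> S" "Xg (Suc i) \<in> S"
  then show "(val (Xg i) * val (Xg (Suc i))) ^ 4 = 1"
    using val_pow2[OF i] S_bounds[of i] S_bounds[of "Suc i"] by (simp add: A2_f_values)
next
  fix i assume i: "Xg i \<in> S" "Xg (Suc i) \<in> S" "Xg (Suc (Suc i)) \<in> S"
  then show "(val (Xg i) * val (Xg (Suc i)) * val (Xg (Suc (Suc i)))) ^ 4 = 1"
    using val_pow3[OF i] S_bounds[of i] S_bounds[of "Suc (Suc i)"] by (simp add: A2_g_values)
next
  fix i assume i: "Xg i \<in> S" "Yg i \<in> S"
  then show "(val (Xg i) * val (Yg i)) ^ 3 = 1"
    using val_pow2[OF i] S_bounds[of i] by (simp add: A2_f_values)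
next
  fix i assume i: "Xg i \<in> S" "Xg (Suc i) \<in> S" "Yg i \<in> S"
  then show "(val (Xg i) * val (Xg (Suc i)) * val (Yg i)) ^ 3 = 1"
    using val_pow3[OF i] S_bounds[of i] S_bounds[of "Suc i"] by (simp add: A2_g_values)
next
  fix i assume i: "Xg i \<in> S" "Xg (Suc i) \<in> S" "Yg (Suc i) \<in> S"
  then show "(val (Xg i) * val (Xg (Suc i)) * val (Yg (Suc i))) ^ 3 = 1"
    using val_pow3[OF i] S_bounds[of i] S_bounds[of "Suc i"] by (simp add: A2_g_values)
qed (auto intro: val_invo val_commute A2_f_values)

lemma pair_Y: "unipotent_pair (val \<circ> Yg) {i. Yg i \<in> S} (val \<circ> Xg) {i. Xg i \<in> S}"
proof (unfold_locales; unfold mem_Collect_eq comp_apply)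
  fix i assume i: "Yg i \<in> S" "Yg (Suc i) \<in> S"
  then show "(val (Yg i) * val (Yg (Suc i))) ^ 4 = 1"
    using val_pow2[OF i] S_bounds[of i] S_bounds[of "Suc i"] by (simp add: A2_f_values)
next
  fix i assume i: "Yg i \<in> S" "Yg (Suc i) \<in> S" "Yg (Suc (Suc i)) \<in> S"
  then show "(val (Yg i) * val (Yg (Suc i)) * val (Yg (Suc (Suc i)))) ^ 4 = 1"
    using val_pow3[OF i] S_bounds[of i] S_bounds[of "Suc (Suc i)"] by (simp add: A2_g_values)
next
  fix i assume i: "Yg i \<in> S" "Xg i \<in> S"
  then show "(val (Yg i) * val (Xg i)) ^ 3 = 1"
    using pow_rot[OF val_invo[OF i(2)]] val_pow2[OF i(2,1)] S_bounds[of i]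
    by (simp add: A2_f_values)
next
  fix i assume i: "Yg i \<in> S" "Yg (Suc i) \<in> S" "Xg i \<in> S"
  then show "(val (Yg i) * val (Yg (Suc i)) * val (Xg i)) ^ 3 = 1"
    using val_pow3[OF i] S_bounds[of i] S_bounds[of "Suc i"] by (simp add: A2_g_values)
next
  fix i assume i: "Yg i \<in> S" "Yg (Suc i) \<in> S" "Xg (Suc i) \<in> S"
  then show "(val (Yg i) * val (Yg (Suc i)) * val (Xg (Suc i))) ^ 3 = 1"
    using val_pow3[OF i] S_bounds[of i] S_bounds[of "Suc i"] by (simp add: A2_g_values)
next
  fix i j assume "Yg i \<in> S" "Xg j \<in> S" "i \<noteq> j"
  then show "commute (val (Yg i)) (val (Xg j))"
    using val_commute[of "Xg j" "Yg i"] by (auto intro: commute_sym A2_f_values)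
qed (auto intro: val_invo val_commute A2_f_values)

lemma A2_action_val:
  "A2_action (val \<circ> Xg) {i. Xg i \<in> S} (val \<circ> Yg) {i. Yg i \<in> S} ract"
proof -
  interpret X: unipotent_pair "val \<circ> Xg" "{i. Xg i \<in> S}" "val \<circ> Yg" "{i. Yg i \<in> S}" by (rule pair_X)
  interpret Y: unipotent_pair "val \<circ> Yg" "{i. Yg i \<in> S}" "val \<circ> Xg" "{i. Xg i \<in> S}" by (rule pair_Y)
  show ?thesis
  proof unfold_locales
    show "0 \<notin> {i. Xg i \<in> S}" "0 \<notin> {i. Yg i \<in> S}" using S_bounds[of 0] by auto
  qed (simp_all add: val_def one_endo_def times_endo_def)
qed

text \<open>Both actions are combined in \<open>val\<close>: if the action on vectors is trivial,
  faithfulness makes the whole value 1, and the other component, evaluated at the class of the empty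
  word, returns the class of w.\<close>

theorem word_kernel:
  assumes w: "set w \<subseteq> S" and id: "\<And>v. foldr transv w v = v"
  shows "(w, []) \<in> pres_eq S rels"
proof -
  interpret A2_action "val \<circ> Xg" "{i. Xg i \<in> S}" "val \<circ> Yg" "{i. Yg i \<in> S}" ract
    by (rule A2_action_val)
  have "val a \<in> gens (val \<circ> Xg) {i. Xg i \<in> S} (val \<circ> Yg) {i. Yg i \<in> S} n" if "a \<in> S" for a
    using that S_bounds by (cases a) (auto simp: gens_def)
  then have "word_val val w \<in> G n"
    using w by (induction w) (auto intro: span_mult span_base span_one)
  then have "word_val val w = 1" by (rule G_faithful) (simp add: ract_val id)
  then have "pres_eq S rels `` {w} = pres_eq S rels `` {[]}"
    using lact_val[OF w, of "[]"] by (simp add: one_endo_def)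
  then show ?thesis using eq_equiv_class[OF _ equiv_pres_eq] by blast
qed

end

section \<open>Matrices and row reduction\<close>

text \<open>Otherwise the simplifier turns sums over bit into cardinalities.\<close>
declare add_bit_eq_xor [simp del] mult_bit_eq_and [simp del]

definition supported :: "nat \<Rightarrow> (nat \<Rightarrow> nat \<Rightarrow> bit) \<Rightarrow> bool" where
  "supported m A \<longleftrightarrow> (\<forall>i j. \<not> (i < m \<and> j < m) \<longrightarrow> A i j = 0)"

lemma supported_mat_mul [simp]: "supported m (mat_mul m A B)"
  and supported_mat_one [simp]: "supported m (mat_one m)"
  by (auto simp: supported_def mat_mul_def mat_one_def)

lemma supported_eqI:
  "supported m A \<Longrightarrow> supported m B \<Longrightarrow> (\<And>i j. i < m \<Longrightarrow> j < m \<Longrightarrow> A i j = B i j) \<Longrightarrow> A = B"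
  unfolding supported_def by (intro ext) metis

lemma mat_mul_assoc: "mat_mul m (mat_mul m A B) C = mat_mul m A (mat_mul m B C)"
proof (rule supported_eqI)
  fix i j assume ij: "i < m" "j < m"
  have "mat_mul m (mat_mul m A B) C i j = (\<Sum>k<m. \<Sum>l<m. A i l * B l k * C k j)"
    using ij by (simp add: mat_mul_def sum_distrib_right)
  also have "\<dots> = (\<Sum>l<m. \<Sum>k<m. A i l * B l k * C k j)" by (rule sum.swap)
  also have "\<dots> = mat_mul m A (mat_mul m B C) i j"
    using ij by (simp add: mat_mul_def sum_distrib_left mult.assoc)
  finally show "mat_mul m (mat_mul m A B) C i j = mat_mul m A (mat_mul m B C) i j" .
qed simp_all

lemma mat_mul_one:
  assumes "supported m A"
  shows "mat_mul m (mat_one m) A = A" "mat_mul m A (mat_one m) = A"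
proof -
  have "mat_mul m (mat_one m) A i j = A i j" "mat_mul m A (mat_one m) i j = A i j"
    if "i < m" "j < m" for i j
  proof -
    have "mat_mul m (mat_one m) A i j = (\<Sum>k<m. if k = i then A k j else 0)"
      unfolding mat_mul_def mat_one_def using that
      by (simp del: sum.delta sum.delta') (intro sum.cong; simp)
    then show "mat_mul m (mat_one m) A i j = A i j" using that by simp
    have "mat_mul m A (mat_one m) i j = (\<Sum>k<m. if k = j then A i k else 0)"
      unfolding mat_mul_def mat_one_def using that
      by (simp del: sum.delta sum.delta') (intro sum.cong; simp)
    then show "mat_mul m A (mat_one m) i j = A i j" using that by simp
  qed
  then show "mat_mul m (mat_one m) A = A" "mat_mul m A (mat_one m) = A"
    by (auto intro!: supported_eqI assms)
qed

definition elem :: "nat \<Rightarrow> nat \<Rightarrow> nat \<Rightarrow> nat \<Rightarrow> nat \<Rightarrow> bit" where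
  "elem m i j = (\<lambda>a b. if a < m \<and> b < m \<and> (a = b \<or> a = i \<and> b = j) then 1 else 0)"

lemma supported_elem [simp]: "supported m (elem m i j)"
  by (auto simp: supported_def elem_def)

lemma elem_left:
  assumes "supported m A" "i < m" "j < m" "i \<noteq> j"
  shows "mat_mul m (elem m i j) A = (\<lambda>a b. if a = i then A i b + A j b else A a b)"
proof (rule supported_eqI)
  show "supported m (\<lambda>a b. if a = i then A i b + A j b else A a b)"
    using assms by (auto simp: supported_def)
  fix a b assume ab: "a < m" "b < m"
  have "mat_mul m (elem m i j) A a b = (\<Sum>k<m. (if k = a then A k b else 0) + (if k = j then if a = i then A k b else 0 else 0))"
    using ab assms(4) unfolding mat_mul_def elem_def by (auto intro!: sum.cong)
  also have "\<dots> = (if a = i then A i b + A j b else A a b)"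
    unfolding sum.distrib using ab assms(2,3) by (simp add: sum.delta)
  finally show "mat_mul m (elem m i j) A a b = (if a = i then A i b + A j b else A a b)" .
qed simp

lemma elem_right:
  assumes "supported m A" "i < m" "j < m" "i \<noteq> j"
  shows "mat_mul m A (elem m i j) = (\<lambda>a b. if b = j then A a j + A a i else A a b)"
proof (rule supported_eqI)
  show "supported m (\<lambda>a b. if b = j then A a j + A a i else A a b)"
    using assms by (auto simp: supported_def)
  fix a b assume ab: "a < m" "b < m"
  have "mat_mul m A (elem m i j) a b = (\<Sum>k<m. (if k = b then A a k else 0) + (if k = i then if b = j then A a k else 0 else 0))"
    using ab assms(4) unfolding mat_mul_def elem_def by (auto intro!: sum.cong)
  also have "\<dots> = (if b = j then A a j + A a i else A a b)"
    unfolding sum.distrib using ab assms(2,3) by (simp add: sum.delta)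
  finally show "mat_mul m A (elem m i j) a b = (if b = j then A a j + A a i else A a b)" .
qed simp

lemma elem_square:
  assumes "i < m" "j < m" "i \<noteq> j"
  shows "mat_mul m (elem m i j) (elem m i j) = mat_one m"
  unfolding elem_left[OF supported_elem assms] using assms
  by (auto simp: elem_def mat_one_def fun_eq_iff)

text \<open>Over F_2 both factors are their own inverses, so the right-hand side is their
  commutator. It builds distant elementary matrices from neighbouring ones in
  \<open>elem_im\<close>.\<close>

lemma elem_commutator:
  assumes "i < m" "j < m" "k < m" "i \<noteq> j" "i \<noteq> k" "j \<noteq> k"
  shows "elem m i j = mat_mul m (elem m i k) (mat_mul m (elem m k j) (mat_mul m (elem m i k) (elem m k j)))"
proof -
  have e: "mat_mul m (elem m a b) A c d = (if c = a then A a d + A b d else A c d)"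
    if "supported m A" "a < m" "b < m" "a \<noteq> b" for A a b c d
    using elem_left[OF that] by simp
  let ?I = "elem m i k" and ?K = "elem m k j"
  define A where "A = mat_mul m ?I ?K"
  define B where "B = mat_mul m ?K A"
  have A: "A a b = (if a = i then ?K i b + ?K k b else ?K a b)" for a b
    unfolding A_def using assms by (intro e) auto
  have B: "B a b = (if a = k then A k b + A j b else A a b)" for a b
    unfolding B_def using assms by (intro e) (auto simp: A_def)
  have C: "mat_mul m ?I B a b = (if a = i then B i b + B k b else B a b)" for a b
    using assms by (intro e) (auto simp: B_def)
  have "elem m i j a b = mat_mul m ?I B a b" for a b
  proof -
    consider "a = i" | "a = k" | "a = j" | "a \<noteq> i" "a \<noteq> k" "a \<noteq> j" by blast
    then show ?thesis
      unfolding C unfolding B unfolding A using assms by cases (auto simp: elem_def)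
  qed
  then show ?thesis unfolding A_def B_def by (intro ext)
qed

lemma GL_set_iff:
  "A \<in> GL_set m \<longleftrightarrow> supported m A \<and> (\<exists>B. supported m B \<and> mat_mul m A B = mat_one m \<and> mat_mul m B A = mat_one m)"
  by (simp add: GL_set_def supported_def)

lemma GL_set_mul:
  assumes "A \<in> GL_set m" "B \<in> GL_set m"
  shows "mat_mul m A B \<in> GL_set m"
proof -
  obtain A' where A: "supported m A" "supported m A'" "mat_mul m A A' = mat_one m" "mat_mul m A' A = mat_one m"
    using assms(1) unfolding GL_set_iff by blast
  obtain B' where B: "supported m B" "supported m B'" "mat_mul m B B' = mat_one m" "mat_mul m B' B = mat_one m"
    using assms(2) unfolding GL_set_iff by blast
  have "mat_mul m (mat_mul m A B) (mat_mul m B' A') = mat_mul m A (mat_mul m (mat_mul m B B') A')"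
    by (simp only: mat_mul_assoc)
  also have "\<dots> = mat_one m" by (simp only: B(3) mat_mul_one(1)[OF A(2)] A(3))
  finally have 1: "mat_mul m (mat_mul m A B) (mat_mul m B' A') = mat_one m" .
  have "mat_mul m (mat_mul m B' A') (mat_mul m A B) = mat_mul m B' (mat_mul m (mat_mul m A' A) B)"
    by (simp only: mat_mul_assoc)
  also have "\<dots> = mat_one m" by (simp only: A(4) mat_mul_one(1)[OF B(1)] B(4))
  finally show ?thesis unfolding GL_set_iff using 1 supported_mat_mul by blast
qed

lemma elem_GL: "i < m \<Longrightarrow> j < m \<Longrightarrow> i \<noteq> j \<Longrightarrow> elem m i j \<in> GL_set m"
  unfolding GL_set_iff using elem_square supported_elem by metis

lemma one_GL: "mat_one m \<in> GL_set m"
  unfolding GL_set_iff using mat_mul_one(1)[OF supported_mat_one] supported_mat_one by metis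

lemma GL_row_col_nonzero:
  assumes "A \<in> GL_set m" "p < m"
  shows "\<exists>k<m. A p k \<noteq> 0" "\<exists>k<m. A k p \<noteq> 0"
proof -
  from assms obtain B where B: "mat_mul m A B = mat_one m" "mat_mul m B A = mat_one m"
    unfolding GL_set_iff by blast
  from fun_cong[OF fun_cong[OF B(1)], of p p] have "(\<Sum>k<m. A p k * B k p) \<noteq> 0"
    using assms(2) by (simp add: mat_mul_def mat_one_def)
  then show "\<exists>k<m. A p k \<noteq> 0" by (metis (no_types, lifting) lessThan_iff mult_zero_left sum.neutral)
  from fun_cong[OF fun_cong[OF B(2)], of p p] have "(\<Sum>k<m. B p k * A k p) \<noteq> 0"
    using assms(2) by (simp add: mat_mul_def mat_one_def)
  then show "\<exists>k<m. A k p \<noteq> 0" by (metis (no_types, lifting) lessThan_iff mult_zero_right sum.neutral)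
qed

section \<open>Words as matrices and the preorder of admissible positions\<close>

context A2_system
begin

abbreviation "m \<equiv> Suc n"

fun gmat :: "gen \<Rightarrow> nat \<Rightarrow> nat \<Rightarrow> bit" where
  "gmat (Xg i) = elem m i (i - 1)"
| "gmat (Yg i) = elem m (i - 1) i"

fun wmat :: "gen list \<Rightarrow> nat \<Rightarrow> nat \<Rightarrow> bit" where
  "wmat [] = mat_one m"
| "wmat (a # w) = mat_mul m (gmat a) (wmat w)"

lemma supported_wmat [simp]: "supported m (wmat w)"
  by (cases w) simp_all

lemma wmat_append: "wmat (u @ v) = mat_mul m (wmat u) (wmat v)"
  by (induction u) (simp_all add: mat_mul_one mat_mul_assoc)

lemma supported_gmat [simp]: "supported m (gmat a)"
  by (cases a) simp_all

text \<open>Links the two actions: words act on the first m coordinates through their matrix and fix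
  the others, so equality of matrices can be tested on vectors
  (\<open>wmat_eq_iff_foldr\<close>).\<close>

lemma foldr_transv_wmat:
  assumes "set w \<subseteq> S"
  shows "foldr transv w v i = (if i < m then \<Sum>k<m. wmat w i k * v k else v i)"
  using assms
proof (induction w arbitrary: i)
  case Nil
  have "(\<Sum>k<m. mat_one m i k * v k) = v i" if "i < m"
  proof -
    have "(\<Sum>k<m. mat_one m i k * v k) = (\<Sum>k<m. if k = i then v k else 0)"
      using that by (intro sum.cong) (auto simp: mat_one_def)
    then show ?thesis using that by simp
  qed
  then show ?case by simp
next
  case (Cons a w)
  let ?u = "foldr transv w v"
  have IH: "?u j = (if j < m then \<Sum>k<m. wmat w j k * v k else v j)" for j
    using Cons by simp
  have sm: "(\<Sum>k<m. (A k + B k) * v k) = (\<Sum>k<m. A k * v k) + (\<Sum>k<m. B k * v k)" for A B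
    by (simp only: distrib_right sum.distrib)
  show ?case
  proof (cases a)
    case (Xg j)
    have j: "1 \<le> j" "j \<le> n" "j - 1 < m" using Cons.prems Xg S_bounds[of j] by auto
    have "wmat (a # w) = (\<lambda>a b. if a = j then wmat w j b + wmat w (j - 1) b else wmat w a b)"
      unfolding Xg wmat.simps gmat.simps using j by (intro elem_left) auto
    then show ?thesis using Xg j IH by (simp del: wmat.simps sum.lessThan_Suc add: sm)
  next
    case (Yg j)
    have j: "1 \<le> j" "j \<le> n" "j - 1 < m" using Cons.prems Yg S_bounds[of j] by auto
    have "wmat (a # w) = (\<lambda>a b. if a = j - 1 then wmat w (j - 1) b + wmat w j b else wmat w a b)"
      unfolding Yg wmat.simps gmat.simps using j by (intro elem_left) auto
    then show ?thesis using Yg j IH by (simp del: wmat.simps sum.lessThan_Suc add: sm)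
  qed
qed

lemma wmat_eq_iff_foldr:
  assumes u: "set u \<subseteq> S" and v: "set v \<subseteq> S"
  shows "wmat u = wmat v \<longleftrightarrow> (\<forall>x. foldr transv u x = foldr transv v x)"
proof
  assume "wmat u = wmat v"
  then show "\<forall>x. foldr transv u x = foldr transv v x"
    using foldr_transv_wmat[OF u] foldr_transv_wmat[OF v] by (auto simp: fun_eq_iff)
next
  assume *: "\<forall>x. foldr transv u x = foldr transv v x"
  have col: "foldr transv w (\<lambda>i. if i = k then 1 else 0) i = wmat w i k"
    if "i < m" "k < m" "set w \<subseteq> S" for w i k
  proof -
    have "(\<Sum>l<m. wmat w i l * (if l = k then 1 else 0)) = (\<Sum>l<m. if l = k then wmat w i l else 0)"
      by (intro sum.cong) auto
    then show ?thesis using that by (simp add: foldr_transv_wmat)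
  qed
  show "wmat u = wmat v"
  proof (rule supported_eqI)
    fix i k assume "i < m" "k < m"
    then show "wmat u i k = wmat v i k" using col[of i k u] col[of i k v] * u v by simp
  qed simp_all
qed

lemma foldr_transv_pres_eq:
  "(u, v) \<in> pres_eq S rels \<Longrightarrow> foldr transv u x = foldr transv v x"
proof (induction arbitrary: x rule: pres_eq.induct)
  case (rel u v r)
  then show ?case using foldr_transv_relator[OF _ S_subset] by (simp add: rels_def)
qed simp_all

lemma square_in_rels: "a \<in> S \<Longrightarrow> [a, a] \<in> rels"
  by (auto simp: rels_def coxeter2_relators_def)

lemma pres_eq_iff_wmat:
  assumes u: "set u \<subseteq> S" and v: "set v \<subseteq> S"
  shows "(u, v) \<in> pres_eq S rels \<longleftrightarrow> wmat u = wmat v"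
proof
  assume "(u, v) \<in> pres_eq S rels"
  then show "wmat u = wmat v"
    using foldr_transv_pres_eq by (simp add: wmat_eq_iff_foldr[OF u v])
next
  assume "wmat u = wmat v"
  then have e: "foldr transv u x = foldr transv v x" for x by (simp add: wmat_eq_iff_foldr[OF u v])
  \<comment> \<open>Since the generators are involutions, \<open>rev u\<close> represents the
    inverse of u. Hence \<open>rev u @ v\<close> acts trivially, and \<open>word_kernel\<close>
    applies.\<close>
  have "(rev u @ rev (rev u), []) \<in> pres_eq S rels" using u by (intro pres_eq_rev square_in_rels) auto
  from foldr_transv_pres_eq[OF this] have "foldr transv (rev u) (foldr transv u x) = x" for x by simp
  then have "foldr transv (rev u @ v) x = x" for x by (simp add: e)
  then have "(rev u @ v, []) \<in> pres_eq S rels" using u v by (intro word_kernel) auto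
  then have 1: "(u @ (rev u @ v) @ [], u @ [] @ []) \<in> pres_eq S rels"
    using u by (intro pres_eq_cong) auto
  have "(u @ rev u, []) \<in> pres_eq S rels" by (intro pres_eq_rev square_in_rels u)
  then have "([] @ (u @ rev u) @ v, [] @ [] @ v) \<in> pres_eq S rels"
    using v by (intro pres_eq_cong) auto
  then have "(v, u @ rev u @ v) \<in> pres_eq S rels" by (auto intro: pres_eq.sym)
  then have "(v, u) \<in> pres_eq S rels" using 1 by (auto intro: pres_eq.trans)
  then show "(u, v) \<in> pres_eq S rels" by (rule pres_eq.sym)
qed

text \<open>The preorder of positions (i, j) at which a matrix of the parabolic intersection may be non-zero.\<close>
definition allowed :: "nat \<Rightarrow> nat \<Rightarrow> bool" where
  "allowed i j \<longleftrightarrow> (\<forall>k. j < k \<and> k \<le> i \<longrightarrow> Xg k \<in> S) \<and> (\<forall>k. i < k \<and> k \<le> j \<longrightarrow> Yg k \<in> S)"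

text \<open>The unit group of the incidence algebra of the preorder \<open>allowed\<close> over
  F_2.\<close>

definition units :: "(nat \<Rightarrow> nat \<Rightarrow> bit) set" where
  "units = {A \<in> GL_set m. \<forall>i j. A i j \<noteq> 0 \<longrightarrow> allowed i j}"

lemma allowed_refl: "allowed i i"
  by (auto simp: allowed_def)

lemma allowed_trans: "allowed i j \<Longrightarrow> allowed j k \<Longrightarrow> allowed i k"
proof -
  assume 1: "allowed i j" and 2: "allowed j k"
  have "Xg l \<in> S" if "k < l" "l \<le> i" for l
    using 1 2 that unfolding allowed_def by (cases "l \<le> j") auto
  moreover have "Yg l \<in> S" if "i < l" "l \<le> k" for l
    using 1 2 that unfolding allowed_def by (cases "l \<le> j") auto
  ultimately show ?thesis unfolding allowed_def by blast
qed

lemma units_mul: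
  assumes "A \<in> units" "B \<in> units"
  shows "mat_mul m A B \<in> units"
proof -
  have "allowed i j" if "mat_mul m A B i j \<noteq> 0" for i j
  proof -
    have "(\<Sum>k<m. A i k * B k j) \<noteq> 0" using that by (simp add: mat_mul_def split: if_splits)
    then obtain k where "A i k * B k j \<noteq> 0" by (meson sum.neutral)
    then show ?thesis using assms allowed_trans[of i k j] by (auto simp: units_def)
  qed
  then show ?thesis using assms GL_set_mul by (auto simp: units_def)
qed

lemma elem_units:
  assumes "i < m" "j < m" "i \<noteq> j" "allowed i j"
  shows "elem m i j \<in> units"
proof -
  have "allowed a b" if "elem m i j a b \<noteq> 0" for a b
    using that assms(4) allowed_refl by (auto simp: elem_def split: if_splits)
  then show ?thesis unfolding units_def using elem_GL[OF assms(1-3)] by blast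
qed

lemma one_units: "mat_one m \<in> units"
proof -
  have "allowed a b" if "mat_one m a b \<noteq> 0" for a b
    using that allowed_refl by (auto simp: mat_one_def split: if_splits)
  then show ?thesis unfolding units_def using one_GL by blast
qed

lemma allowed_step:
  "Xg i \<in> S \<Longrightarrow> allowed i (i - 1)" "Yg i \<in> S \<Longrightarrow> allowed (i - 1) i"
proof -
  have "k = i" if "i - 1 < k" "k \<le> i" for k using that by linarith
  then show "Xg i \<in> S \<Longrightarrow> allowed i (i - 1)" "Yg i \<in> S \<Longrightarrow> allowed (i - 1) i"
    unfolding allowed_def by auto
qed

lemma wmat_units: "set w \<subseteq> S \<Longrightarrow> wmat w \<in> units"
proof (induction w)
  case (Cons a w)
  have "gmat a \<in> units"
  proof (cases a)
    case (Xg i)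
    then have "1 \<le> i" "i \<le> n" "allowed i (i - 1)"
      using Cons.prems S_bounds allowed_step by auto
    then show ?thesis using Xg by (auto intro!: elem_units)
  next
    case (Yg i)
    then have "1 \<le> i" "i \<le> n" "allowed (i - 1) i"
      using Cons.prems S_bounds allowed_step by auto
    then show ?thesis using Yg by (auto intro!: elem_units)
  qed
  then show ?case using Cons by (simp add: units_mul)
qed (simp add: one_units)

definition im :: "(nat \<Rightarrow> nat \<Rightarrow> bit) set" where
  "im = wmat ` lists S"

lemma im_mul: "A \<in> im \<Longrightarrow> B \<in> im \<Longrightarrow> mat_mul m A B \<in> im"
  unfolding im_def using wmat_append[symmetric] by (fastforce intro: image_eqI)

lemma elem_im:
  assumes "i < m" "j < m" "i \<noteq> j" "allowed i j"
  shows "elem m i j \<in> im"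
proof -
  have lower: "elem m i j \<in> im" if "j < i" "i < m" "\<And>k. j < k \<Longrightarrow> k \<le> i \<Longrightarrow> Xg k \<in> S" for i j
    using that
  proof (induction i)
    case (Suc i)
    have base: "elem m (Suc i) i \<in> im"
      unfolding im_def using Suc.prems
      by (intro image_eqI[of _ _ "[Xg (Suc i)]"]) (simp_all add: mat_mul_one)
    show ?case
    proof (cases "j = i")
      case False
      then have "elem m i j \<in> im" using Suc by simp
      moreover have "elem m (Suc i) j = mat_mul m (elem m (Suc i) i) (mat_mul m (elem m i j) (mat_mul m (elem m (Suc i) i) (elem m i j)))"
        using Suc.prems False by (intro elem_commutator) auto
      ultimately show ?thesis using base by (simp add: im_mul)
    qed (use base in simp)
  qed simp
  have upper: "elem m j i \<in> im" if "j < i" "i < m" "\<And>k. j < k \<Longrightarrow> k \<le> i \<Longrightarrow> Yg k \<in> S" for i j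
    using that
  proof (induction i)
    case (Suc i)
    have base: "elem m i (Suc i) \<in> im"
      unfolding im_def using Suc.prems
      by (intro image_eqI[of _ _ "[Yg (Suc i)]"]) (simp_all add: mat_mul_one)
    show ?case
    proof (cases "j = i")
      case False
      then have "elem m j i \<in> im" using Suc by simp
      moreover have "elem m j (Suc i) = mat_mul m (elem m j i) (mat_mul m (elem m i (Suc i)) (mat_mul m (elem m j i) (elem m i (Suc i))))"
        using Suc.prems False by (intro elem_commutator) auto
      ultimately show ?thesis using base by (simp add: im_mul)
    qed (use base in simp)
  qed simp
  show ?thesis using lower[of j i] upper[of i j] assms by (cases "j < i") (auto simp: allowed_def)
qed

lemma elem_cancel_left:
  assumes "i < m" "j < m" "i \<noteq> j" "allowed i j" "supported m A" "mat_mul m (elem m i j) A \<in> im"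
  shows "A \<in> im"
proof -
  have "mat_mul m (elem m i j) (mat_mul m (elem m i j) A) = A"
    using assms by (simp add: elem_square mat_mul_one flip: mat_mul_assoc)
  then show ?thesis using im_mul[OF elem_im[OF assms(1-4)] assms(6)] by simp
qed

lemma elem_cancel_right:
  assumes "i < m" "j < m" "i \<noteq> j" "allowed i j" "supported m A" "mat_mul m A (elem m i j) \<in> im"
  shows "A \<in> im"
proof -
  have "mat_mul m (mat_mul m A (elem m i j)) (elem m i j) = A"
    using assms by (simp add: elem_square mat_mul_one mat_mul_assoc)
  then show ?thesis using im_mul[OF assms(6) elem_im[OF assms(1-4)]] by simp
qed

definition trivial_from :: "nat \<Rightarrow> (nat \<Rightarrow> nat \<Rightarrow> bit) \<Rightarrow> bool" where
  "trivial_from k A \<longleftrightarrow> (\<forall>a b. k \<le> a \<or> k \<le> b \<longrightarrow> A a b = mat_one m a b)"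

lemma units_supported: "A \<in> units \<Longrightarrow> supported m A"
  by (simp add: units_def GL_set_iff)

text \<open>Each non-zero entry licenses its own removal: A a p being non-zero makes (a, p) an
  allowed position, hence row p may be added to row a, and similarly for columns. The measure counts
  the non-zero off-diagonal entries left in the cross.\<close>

lemma clear_cross:
  assumes "p < m" and IH: "\<And>A. A \<in> units \<Longrightarrow> trivial_from p A \<Longrightarrow> A \<in> im"
    and "A \<in> units" "trivial_from (Suc p) A" "A p p = 1"
  shows "A \<in> im"
  using assms(3-)
proof (induction "card {(a, b). a < p \<and> b = p \<and> A a b \<noteq> 0 \<or> a = p \<and> b < p \<and> A a b \<noteq> 0}"
    arbitrary: A rule: less_induct)
  case less
  let ?Z = "\<lambda>A :: nat \<Rightarrow> nat \<Rightarrow> bit. {(a, b). a < p \<and> b = p \<and> A a b \<noteq> 0 \<or> a = p \<and> b < p \<and> A a b \<noteq> 0}"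
  have fin: "finite (?Z A)" for A by (rule finite_subset[of _ "{..p} \<times> {..p}"]) auto
  note sup = units_supported[OF less.prems(1)]
  consider "\<forall>a<p. A a p = 0 \<and> A p a = 0" | a where "a < p" "A a p \<noteq> 0" | a where "a < p" "A p a \<noteq> 0" by blast
  then show ?case
  proof cases
    case 1
    have "trivial_from p A"
      unfolding trivial_from_def
    proof (intro allI impI)
      fix a b assume "p \<le> a \<or> p \<le> b"
      then show "A a b = mat_one m a b"
      proof (cases "Suc p \<le> a \<or> Suc p \<le> b")
        case True
        then show ?thesis using less.prems(2) unfolding trivial_from_def by blast
      next
        case False
        then have "a = p \<and> b = p \<or> a = p \<and> b < p \<or> a < p \<and> b = p" using \<open>p \<le> a \<or> p \<le> b\<close> by linarith
        then show ?thesis using 1 less.prems(3) assms(1) by (auto simp: mat_one_def)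
      qed
    qed
    then show ?thesis using IH less.prems by blast
  next
    case 2
    let ?B = "mat_mul m (elem m a p) A"
    have B: "?B = (\<lambda>i b. if i = a then A a b + A p b else A i b)"
      using 2 assms(1) sup by (intro elem_left) auto
    have al: "allowed a p" using 2 less.prems(1) by (auto simp: units_def)
    have u: "?B \<in> units" using 2 assms(1) less.prems(1) al by (intro units_mul elem_units) auto
    have tr: "trivial_from (Suc p) ?B"
      unfolding trivial_from_def
    proof (intro allI impI)
      fix i b assume "Suc p \<le> i \<or> Suc p \<le> b"
      then show "?B i b = mat_one m i b"
        using less.prems(2)[unfolded trivial_from_def] 2(1) unfolding B by (auto simp: mat_one_def)
    qed
    have pp: "?B p p = 1" unfolding B using 2 less.prems by simp
    have ps: "?Z ?B \<subset> ?Z A"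
    proof (rule psubsetI)
      show "?Z ?B \<subseteq> ?Z A" unfolding B using 2 less.prems(3) by auto
      have "(a, p) \<in> ?Z A" "(a, p) \<notin> ?Z ?B" unfolding B using 2 less.prems(3) by auto
      then show "?Z ?B \<noteq> ?Z A" by blast
    qed
    have "?B \<in> im" by (rule less.hyps[OF psubset_card_mono[OF fin ps] u tr pp])
    then show ?thesis using elem_cancel_left[OF _ assms(1) _ al sup] 2 assms(1) by simp
  next
    case 3
    let ?B = "mat_mul m A (elem m p a)"
    have B: "?B = (\<lambda>i b. if b = a then A i a + A i p else A i b)"
      using 3 assms(1) sup by (intro elem_right) auto
    have al: "allowed p a" using 3 less.prems(1) by (auto simp: units_def)
    have u: "?B \<in> units" using 3 assms(1) less.prems(1) al by (intro units_mul elem_units) auto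
    have tr: "trivial_from (Suc p) ?B"
      unfolding trivial_from_def
    proof (intro allI impI)
      fix i b assume "Suc p \<le> i \<or> Suc p \<le> b"
      then show "?B i b = mat_one m i b"
        using less.prems(2)[unfolded trivial_from_def] 3(1) unfolding B by (auto simp: mat_one_def)
    qed
    have pp: "?B p p = 1" unfolding B using 3 less.prems by simp
    have ps: "?Z ?B \<subset> ?Z A"
    proof (rule psubsetI)
      show "?Z ?B \<subseteq> ?Z A" unfolding B using 3 less.prems(3) by auto
      have "(p, a) \<in> ?Z A" "(p, a) \<notin> ?Z ?B" unfolding B using 3 less.prems(3) by auto
      then show "?Z ?B \<noteq> ?Z A" by blast
    qed
    have "?B \<in> im" by (rule less.hyps[OF psubset_card_mono[OF fin ps] u tr pp])
    then show ?thesis using elem_cancel_right[OF assms(1) _ _ al sup] 3 assms(1) by simp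
  qed
qed

lemma units_im: "A \<in> units \<Longrightarrow> trivial_from k A \<Longrightarrow> k \<le> m \<Longrightarrow> A \<in> im"
proof (induction k arbitrary: A)
  case 0
  then have "A = wmat []" by (auto simp: trivial_from_def fun_eq_iff)
  then show ?case unfolding im_def by (metis image_eqI lists.Nil)
next
  case (Suc p)
  then have p: "p < m" by simp
  have IH: "\<And>A. A \<in> units \<Longrightarrow> trivial_from p A \<Longrightarrow> A \<in> im" using Suc by simp
  note sup = units_supported[OF Suc.prems(1)]
  show ?case
  proof (cases "A p p = 1")
    case True
    then show ?thesis using clear_cross[OF p IH] Suc.prems by blast
  next
    case False
    then have pp: "A p p = 0" by simp
    have GL: "A \<in> GL_set m" using Suc.prems by (simp add: units_def)
    have below: "k < p" if "A p k \<noteq> 0 \<or> A k p \<noteq> 0" for k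
    proof (rule ccontr)
      assume "\<not> k < p"
      moreover have "k \<noteq> p" using that pp by auto
      ultimately have "Suc p \<le> k" by simp
      then have "A p k = 0" "A k p = 0" using Suc.prems(2) by (auto simp: trivial_from_def mat_one_def)
      then show False using that by simp
    qed
    obtain j where j: "A p j \<noteq> 0" using GL_row_col_nonzero(1)[OF GL p] by blast
    obtain i where i: "A i p \<noteq> 0" using GL_row_col_nonzero(2)[OF GL p] by blast
    have jp: "j < p" and ip: "i < p" using below i j by blast+
    have al: "allowed p j" "allowed i p" using Suc.prems(1) i j by (auto simp: units_def)
    \<comment> \<open>The entry (p, j) guarantees x_k for j < k <= p, and the entry (i, p)
      guarantees y_k for i < k <= p. For the larger of i and j both families are available, so it is
      equivalent to p.\<close>
    have "allowed j p \<or> allowed p i"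
    proof (cases "i \<le> j")
      case True
      then show ?thesis using al(2) jp unfolding allowed_def by auto
    next
      case False
      then show ?thesis using al(1) ip unfolding allowed_def by auto
    qed
    then show ?thesis
    proof
      assume a: "allowed j p"
      let ?B = "mat_mul m A (elem m j p)"
      have B: "?B = (\<lambda>a b. if b = p then A a p + A a j else A a b)"
        using p jp sup by (intro elem_right) auto
      have "?B \<in> units" using p jp Suc.prems(1) a by (intro units_mul elem_units) auto
      moreover have "trivial_from (Suc p) ?B"
        unfolding trivial_from_def
      proof (intro allI impI)
        fix a b assume "Suc p \<le> a \<or> Suc p \<le> b"
        then show "?B a b = mat_one m a b"
          using Suc.prems(2)[unfolded trivial_from_def] jp unfolding B by (auto simp: mat_one_def)
      qed
      moreover have "?B p p = 1" unfolding B using pp j by simp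
      ultimately have "?B \<in> im" using clear_cross[OF p IH] by blast
      then show ?thesis using elem_cancel_right[OF _ p _ a sup] p jp by simp
    next
      assume a: "allowed p i"
      let ?B = "mat_mul m (elem m p i) A"
      have B: "?B = (\<lambda>a b. if a = p then A p b + A i b else A a b)"
        using p ip sup by (intro elem_left) auto
      have "?B \<in> units" using p ip Suc.prems(1) a by (intro units_mul elem_units) auto
      moreover have "trivial_from (Suc p) ?B"
        unfolding trivial_from_def
      proof (intro allI impI)
        fix a b assume "Suc p \<le> a \<or> Suc p \<le> b"
        then show "?B a b = mat_one m a b"
          using Suc.prems(2)[unfolded trivial_from_def] ip unfolding B by (auto simp: mat_one_def)
      qed
      moreover have "?B p p = 1" unfolding B using pp i by simp
      ultimately have "?B \<in> im" using clear_cross[OF p IH] by blast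
      then show ?thesis using elem_cancel_left[OF p _ _ a sup] p ip by simp
    qed
  qed
qed

lemma units_eq: "units = wmat ` lists S"
proof
  show "wmat ` lists S \<subseteq> units" using wmat_units by auto
  have "trivial_from m A" if "A \<in> units" for A
    using units_supported[OF that] by (auto simp: trivial_from_def supported_def mat_one_def)
  then show "units \<subseteq> wmat ` lists S" using units_im[of _ m] by (auto simp: im_def)
qed

end

section \<open>Identification with the parabolic intersection\<close>

lemma block_of_le_iff:
  assumes "finite (stopovers lam)"
  shows "block_of lam i \<le> block_of lam j \<longleftrightarrow> (\<forall>k. j < k \<and> k \<le> i \<longrightarrow> k \<notin> stopovers lam)"
proof (cases "i \<le> j")
  case True
  then have "block_of lam i \<le> block_of lam j"
    unfolding block_of_def using assms by (intro card_mono) auto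
  then show ?thesis using True by auto
next
  case False
  let ?I = "{s \<in> stopovers lam. s \<le> i}" and ?J = "{s \<in> stopovers lam. s \<le> j}"
  have "?J \<subseteq> ?I" using False by auto
  \<comment> \<open>The two initial segments of stopovers are nested, so this comparison of
    cardinalities holds only if they coincide, that is, if no stopover lies strictly above j and at
    most i.\<close>
  then have "card ?I \<le> card ?J \<longleftrightarrow> ?I \<subseteq> ?J"
    using assms card_seteq[of ?I ?J] card_mono[of ?J ?I] by auto
  then show ?thesis unfolding block_of_def using False by (auto simp: not_le)
qed

lemma finite_stopovers: "finite (stopovers lam)"
  unfolding stopovers_def by (rule finite_subset[of _ "(\<lambda>k. sum_list (take k lam)) ` {..<length lam}"]) auto

lemma transpose_mat_mul: "(\<lambda>i j. mat_mul m A B j i) = mat_mul m (\<lambda>i j. B j i) (\<lambda>i j. A j i)"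
  by (auto simp: mat_mul_def fun_eq_iff mult.commute)

lemma transpose_GL:
  assumes "A \<in> GL_set m"
  shows "(\<lambda>i j. A j i) \<in> GL_set m"
proof -
  obtain B where B: "supported m A" "supported m B" "mat_mul m A B = mat_one m" "mat_mul m B A = mat_one m"
    using assms unfolding GL_set_iff by blast
  have one: "(\<lambda>i j. mat_one m j i) = mat_one m" by (auto simp: mat_one_def fun_eq_iff)
  have "mat_mul m (\<lambda>i j. A j i) (\<lambda>i j. B j i) = mat_one m" "mat_mul m (\<lambda>i j. B j i) (\<lambda>i j. A j i) = mat_one m"
    using B one transpose_mat_mul[of m A B] transpose_mat_mul[of m B A] by simp_all
  moreover have "supported m (\<lambda>i j. A j i)" "supported m (\<lambda>i j. B j i)"
    using B by (auto simp: supported_def)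
  ultimately show ?thesis unfolding GL_set_iff by blast
qed

lemma S_lm_subset: "S_lm n lam mu \<subseteq> A2_X n"
  by (auto simp: S_lm_def A2_X_def)

text \<open>The block condition for lam governs positions below the diagonal and gives the x part of
  \<open>allowed\<close>; the one for mu is transposed and gives the y part. Every k strictly above
  the smaller and at most the larger of i and j lies between 1 and n, the range in which
  \<open>S_lm\<close> is the complement of the stopovers.\<close>

lemma carrier_P_lm:
  "carrier (P_lm_group n lam mu) = A2_system.units n (S_lm n lam mu)"
proof -
  interpret A2_system n "S_lm n lam mu" by unfold_locales (rule S_lm_subset)
  have al: "allowed i j \<longleftrightarrow> block_of lam i \<le> block_of lam j \<and> block_of mu j \<le> block_of mu i"
    if "i < Suc n" "j < Suc n" for i j
  proof -
    have "Xg k \<in> S_lm n lam mu \<longleftrightarrow> k \<notin> stopovers lam" "Yg k \<in> S_lm n lam mu \<longleftrightarrow> k \<notin> stopovers mu"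
      if "1 \<le> k" "k \<le> n" for k
      using that by (auto simp: S_lm_def)
    moreover have "1 \<le> k \<and> k \<le> n" if "j < k \<and> k \<le> i \<or> i < k \<and> k \<le> j" for k
      using that \<open>i < Suc n\<close> \<open>j < Suc n\<close> by linarith
    ultimately show ?thesis
      unfolding block_of_le_iff[OF finite_stopovers] allowed_def by blast
  qed
  have ij: "i < Suc n \<and> j < Suc n" if "A \<in> GL_set (Suc n)" "A i j \<noteq> 0" for A i j
    using that unfolding GL_set_iff supported_def by blast
  have "A \<in> P_set m lam \<and> (\<lambda>i j. A j i) \<in> P_set m mu \<longleftrightarrow> A \<in> units" for A
  proof
    assume "A \<in> P_set m lam \<and> (\<lambda>i j. A j i) \<in> P_set m mu"
    then have A: "A \<in> GL_set m" and "\<And>i j. A i j \<noteq> 0 \<Longrightarrow> block_of lam i \<le> block_of lam j"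
      "\<And>i j. A i j \<noteq> 0 \<Longrightarrow> block_of mu j \<le> block_of mu i"
      by (auto simp: P_set_def)
    then have "allowed i j" if "A i j \<noteq> 0" for i j
      using al ij[OF A that] that by blast
    then show "A \<in> units" using A by (simp add: units_def)
  next
    assume A: "A \<in> units"
    then have GL: "A \<in> GL_set m" by (simp add: units_def)
    have "block_of lam i \<le> block_of lam j \<and> block_of mu j \<le> block_of mu i" if "A i j \<noteq> 0" for i j
      using al ij[OF GL that] A that unfolding units_def by blast
    then show "A \<in> P_set m lam \<and> (\<lambda>i j. A j i) \<in> P_set m mu"
      using GL transpose_GL[OF GL] by (simp add: P_set_def)
  qed
  then show ?thesis by (auto simp: P_lm_group_def)
qed

theorem theorem1:
  fixes n :: nat and lam mu :: "nat list"
  assumes "is_decomposition lam (Suc n)" and "is_decomposition mu (Suc n)"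
  shows "P_lm_group n lam mu \<cong> A2_group n (S_lm n lam mu)"
proof -
  interpret A2_system n "S_lm n lam mu" by unfold_locales (rule S_lm_subset)
  show ?thesis
    unfolding A2_group_def coxeter2_group_def rels_def[symmetric]
  proof (rule presented_group_iso)
    show "carrier (P_lm_group n lam mu) = wmat ` lists (S_lm n lam mu)"
      by (simp add: carrier_P_lm units_eq)
    show "wmat (u @ v) = wmat u \<otimes>\<^bsub>P_lm_group n lam mu\<^esub> wmat v" for u v
      by (simp add: P_lm_group_def wmat_append)
  qed (rule pres_eq_iff_wmat)
qed

end
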